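(* The curve $r\mapsto(r+c(r),c(r))$, $r\ge 0$, is continuous and strictly decreasing in the sense that $0\le r<r'$ implies $r+c(r)<r'+c(r')$ and $c(r)>c(r')$.
   Context: Let $N\ge 1$ be an integer and let $\Omega\subset\mathbb{R}^N$ be a bounded domain (open and connected) with $C^{1,1}$ boundary. $\|\cdot\|_2$ is the $L^2(\Omega)$ norm; $u^\pm=\max\{\pm u,0\}$. Put $c_N=\pi^{-N/2}\Gamma(N/2)$ and $\rho_N=2\ln 2+\psi(N/2)-\gamma$, with $\psi=\Gamma'/\Gamma$ the digamma function and $\gamma=-\Gamma'(1)$; $B_1$ is the unit ball centred at $0$, $k(z)=\mathbf 1_{B_1}(z)|z|^{-N}$, $j(z)=\mathbf 1_{\mathbb{R}^N\setminus B_1}(z)|z|^{-N}$ for $z\neq 0$. $\mathbb{H}(\Omega)$ is the Hilbert space of all $u\in L^2(\Omega)$, extended by $u=0$ in $\mathbb{R}^N\setminus\Omega$, with $\iint_{\mathbb{R}^{2N}}|u(x)-u(y)|^2k(x-y)\,dx\,dy<\infty$, with inner product $\mathcal{E}(u,v)=\frac{c_N}{2}\iint_{\mathbb{R}^{2N}}(u(x)-u(y))(v(x)-v(y))k(x-y)\,dx\,dy$ and norm $\|u\|=\mathcal{E}(u,u)^{1/2}$. The quadratic form of the logarithmic Laplacian is $$\mathcal{E}_L(u,v)=\mathcal{E}(u,v)-c_N\iint_{\mathbb{R}^{2N}}u(x)v(y)j(x-y)\,dx\,dy+\rho_N\int_{\mathbb{R}^N}uv\,dx .$$ The first eigenvalue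 is $\lambda_1^L=\min\{\mathcal{E}_L(u,u):u\in\mathbb{H}(\Omega),\|u\|_2=1\}$; it is simple, and $\varphi_1>0$ denotes the associated minimizer (eigenfunction) with $\|\varphi_1\|_2=1$. Let $\mathcal{P}=\{u\in\mathbb{H}(\Omega): \int_\Omega u^2\,dx=1\}$ (with the topology of $\mathbb{H}(\Omega)$), $E_r(u)=\mathcal{E}_L(u,u)-r\int_\Omega(u^+)^2\,dx$, $\Gamma=\{\gamma\in C([-1,1],\mathcal{P}):\gamma(-1)=-\varphi_1,\ \gamma(1)=\varphi_1\}$, and $c(r)=\inf_{\gamma\in\Gamma}\max_{u\in\gamma[-1,1]}E_r(u)$. *)

theory Defs
  imports "HOL-Analysis.Analysis"
begin

text \<open>
  \<open>\<real>\<^sup>N\<close> is an arbitrary type \<open>'a\<close> of class \<open>euclidean_space\<close>, with \<open>N = DIM('a) \<ge> 1\<close>.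
  Elements of \<open>L\<^sup>2\<close> are represented by Borel functions; equality of classes is equality
  almost everywhere.
\<close>

definition C11_function :: "('a::euclidean_space \<Rightarrow> real) \<Rightarrow> bool" where
  "C11_function g \<longleftrightarrow>
     (\<exists>D L. (\<forall>x. GDERIV g x :> D x) \<and> L-lipschitz_on UNIV D)"

text \<open>
  Near each boundary point \<open>\<Omega>\<close> is, in a suitable orthonormal frame with last axis \<open>e\<close>, the part
  of a ball lying above the graph of a \<open>C\<^sup>1\<^sup>,\<^sup>1\<close> function. That function of \<open>N - 1\<close> variables is
  given as a function \<open>g\<close> on the whole space which is only evaluated on the hyperplane orthogonal
  to \<open>e\<close>; any \<open>C\<^sup>1\<^sup>,\<^sup>1\<close> function on the hyperplane extends to such a \<open>g\<close> by composition with the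
  orthogonal projection.
\<close>

definition C11_boundary :: "'a::euclidean_space set \<Rightarrow> bool" where
  "C11_boundary \<Omega> \<longleftrightarrow>
     (\<forall>p\<in>frontier \<Omega>. \<exists>e s g. norm e = 1 \<and> 0 < s \<and> C11_function g \<and>
        \<Omega> \<inter> ball p s = {x \<in> ball p s. g (x - (x \<bullet> e) *\<^sub>R e) < x \<bullet> e})"

definition bounded_C11_domain :: "'a::euclidean_space set \<Rightarrow> bool" where
  "bounded_C11_domain \<Omega> \<longleftrightarrow>
     \<Omega> \<noteq> {} \<and> open \<Omega> \<and> connected \<Omega> \<and> bounded \<Omega> \<and> C11_boundary \<Omega>"

definition c_const :: "'a::euclidean_space itself \<Rightarrow> real" where
  "c_const _ = pi powr (- real DIM('a) / 2) * Gamma (real DIM('a) / 2)"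

definition rho_const :: "'a::euclidean_space itself \<Rightarrow> real" where
  "rho_const _ = 2 * ln 2 + Digamma (real DIM('a) / 2) - euler_mascheroni"

text \<open>Both kernels take the value \<open>0\<close> at the origin (division by zero);
  the diagonal is a null set of the product space.\<close>

definition kern_k :: "'a::euclidean_space \<Rightarrow> real" where
  "kern_k z = indicator (ball 0 1) z / norm z ^ DIM('a)"

definition kern_j :: "'a::euclidean_space \<Rightarrow> real" where
  "kern_j z = indicator (- ball 0 1) z / norm z ^ DIM('a)"

definition HH :: "'a::euclidean_space set \<Rightarrow> ('a \<Rightarrow> real) set" where
  "HH \<Omega> = {u \<in> borel_measurable borel.
     (\<forall>x. x \<notin> \<Omega> \<longrightarrow> u x = 0) \<and>
     set_integrable lborel \<Omega> (\<lambda>x. (u x)\<^sup>2) \<and>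
     integrable (lborel \<Otimes>\<^sub>M lborel) (\<lambda>(x, y). \<bar>u x - u y\<bar>\<^sup>2 * kern_k (x - y))}"

definition form_E :: "('a::euclidean_space \<Rightarrow> real) \<Rightarrow> ('a \<Rightarrow> real) \<Rightarrow> real" where
  "form_E u v = c_const TYPE('a) / 2 *
     (LINT (x, y)|(lborel \<Otimes>\<^sub>M lborel). (u x - u y) * (v x - v y) * kern_k (x - y))"

definition norm_H :: "('a::euclidean_space \<Rightarrow> real) \<Rightarrow> real" where
  "norm_H u = sqrt (form_E u u)"

definition form_EL :: "('a::euclidean_space \<Rightarrow> real) \<Rightarrow> ('a \<Rightarrow> real) \<Rightarrow> real" where
  "form_EL u v = form_E u v
     - c_const TYPE('a) * (LINT (x, y)|(lborel \<Otimes>\<^sub>M lborel). u x * v y * kern_j (x - y))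
     + rho_const TYPE('a) * (LINT x|lborel. u x * v x)"

definition PP :: "'a::euclidean_space set \<Rightarrow> ('a \<Rightarrow> real) set" where
  "PP \<Omega> = {u \<in> HH \<Omega>. (LINT x:\<Omega>|lborel. (u x)\<^sup>2) = 1}"

text \<open>The minimal value \<open>form_EL \<phi> \<phi>\<close> is the first eigenvalue.\<close>

definition first_eigenfunction :: "'a::euclidean_space set \<Rightarrow> ('a \<Rightarrow> real) \<Rightarrow> bool" where
  "first_eigenfunction \<Omega> \<phi> \<longleftrightarrow>
     is_arg_min (\<lambda>u. form_EL u u) (\<lambda>u. u \<in> PP \<Omega>) \<phi> \<and>
     (AE x in lborel. x \<in> \<Omega> \<longrightarrow> 0 < \<phi> x)"

definition E_r :: "'a::euclidean_space set \<Rightarrow> real \<Rightarrow> ('a \<Rightarrow> real) \<Rightarrow> real" where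
  "E_r \<Omega> r u = form_EL u u - r * (LINT x:\<Omega>|lborel. (max (u x) 0)\<^sup>2)"

text \<open>Paths are continuous with respect to \<open>norm_H\<close>. Only the restriction of \<open>\<gamma>\<close> to
  \<open>[-1, 1]\<close> matters.\<close>

definition paths :: "'a::euclidean_space set \<Rightarrow> ('a \<Rightarrow> real) \<Rightarrow> (real \<Rightarrow> 'a \<Rightarrow> real) set" where
  "paths \<Omega> \<phi> = {\<gamma>.
     (\<forall>t\<in>{-1..1}. \<gamma> t \<in> PP \<Omega>) \<and>
     (\<forall>t\<in>{-1..1}. ((\<lambda>s. norm_H (\<lambda>x. \<gamma> s x - \<gamma> t x)) \<longlongrightarrow> 0) (at t within {-1..1})) \<and>
     (AE x in lborel. \<gamma> (-1) x = - \<phi> x) \<and>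
     (AE x in lborel. \<gamma> 1 x = \<phi> x)}"

definition minimax_c :: "'a::euclidean_space set \<Rightarrow> ('a \<Rightarrow> real) \<Rightarrow> real \<Rightarrow> real" where
  "minimax_c \<Omega> \<phi> r = (INF \<gamma>\<in>paths \<Omega> \<phi>. GREATEST m. m \<in> E_r \<Omega> r ` \<gamma> ` {-1..1})"

end

theory Submission
  imports Defs
begin

text \<open>
Write \<open>c(r)\<close> for the minimax level, \<open>\<lambda>\<^sub>1 = form_EL \<phi> \<phi>\<close>, \<open>mass u = \<integral> u\<^sup>2\<close> and \<open>u\<^sup>+\<close> for the positive
part.

If \<open>\<gamma>\<close> is an admissible path, so is \<open>t \<mapsto> - \<gamma> (- t)\<close>, and on the unit sphere
\<open>mass u\<^sup>+ = 1 - mass (- u)\<^sup>+\<close>. Hence \<open>c(- r) = r + c(r)\<close> (\<open>minimax_reflect\<close>). The two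
strict inequalities are therefore one and the same: \<open>c\<close> is strictly decreasing on the whole real
line (\<open>minimax_strict\<close>). Together they give \<open>0 < c(r) - c(r') < r' - r\<close> for \<open>r < r'\<close>, so \<open>c\<close> is
1-Lipschitz and the curve is continuous.

For the strict decrease, note that the quadratic form \<open>excess u = form_EL u u - \<lambda>\<^sub>1 mass u\<close> is nonnegative and
vanishes at \<open>\<phi>\<close>, so it is invariant under \<open>u \<mapsto> u - s \<phi>\<close> (\<open>excess_shift\<close>). Take a path that is
almost optimal for \<open>r\<close>. Where \<open>mass u\<^sup>+\<close> is not small, the level for \<open>r'\<close> lies below the level for
\<open>r\<close> by \<open>(r' - r) mass u\<^sup>+\<close>, a definite amount. Where \<open>mass u\<^sup>+\<close> is small, \<open>u\<close> is replaced by
the normalisation of \<open>u - s \<phi>\<close>: the excess stays the same, while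
\<open>mass (u - s \<phi>) = 1 - 2 s \<langle>u, \<phi>\<rangle> + s\<^sup>2\<close> grows at a linear rate in \<open>s\<close>, because
\<open>\<langle>u, \<phi>\<rangle> \<le> - \<kappa> < 0\<close> there (\<open>overlap_with_phi\<close>). Normalising divides the excess by this factor, and
since \<open>c(r) > \<lambda>\<^sub>1\<close> the level drops again by a definite amount. With \<open>s = max 0 (\<eta> - mass u\<^sup>+)\<close> one
continuous deformation does both, and it fixes the end points.

That \<open>c(r) > \<lambda>\<^sub>1\<close> holds because every path crosses the set \<open>mass u\<^sup>+ = \<eta>\<close>. There the nonlocal interaction
of \<open>u\<^sup>+\<close> with \<open>u\<^sup>-\<close> contributes at least a multiple of \<open>\<integral> u\<^sup>+ \<cdot> \<integral> u\<^sup>-\<close> to the energy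
(\<open>form_EL_split\<close>), which is of order \<open>\<surd>\<eta>\<close> unless the energy of \<open>u\<^sup>+\<close> is already large compared
with \<open>\<eta>\<close>; both possibilities beat the term \<open>r \<eta>\<close> when \<open>\<eta>\<close> is small (\<open>barrier\<close>).

Both steps need that a function of unit mass and bounded energy cannot have
small \<open>L\<^sup>1\<close> norm (\<open>L1_lower_bound\<close>). This replaces the compact embedding into \<open>L\<^sup>2\<close>; it holds because
the kernel \<open>\<bar>z\<bar>\<^sup>-\<^sup>N\<close> is not integrable at the origin (\<open>mass_le_energy_L1\<close>).
\<close>

section \<open>Functions of finite energy\<close>

lemma integrable_tensor:
  fixes f g :: "'a::euclidean_space \<Rightarrow> real"
  assumes f: "integrable lborel f" and g: "integrable lborel g"
  shows "integrable (lborel \<Otimes>\<^sub>M lborel) (\<lambda>(x, y). f x * g y)"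
    and "(LINT (x, y)|(lborel \<Otimes>\<^sub>M lborel). f x * g y) = (LINT x|lborel. f x) * (LINT x|lborel. g x)"
proof -
  have [measurable]: "f \<in> borel_measurable borel" "g \<in> borel_measurable borel"
    using f g by (auto dest: borel_measurable_integrable)
  show I: "integrable (lborel \<Otimes>\<^sub>M lborel) (\<lambda>(x, y). f x * g y)"
    by (intro lborel_pair.Fubini_integrable) (use f g in \<open>auto simp: abs_mult\<close>)
  show "(LINT (x, y)|(lborel \<Otimes>\<^sub>M lborel). f x * g y) = (LINT x|lborel. f x) * (LINT x|lborel. g x)"
    using lborel_pair.integral_fst'[OF I] by simp
qed

lemma kern_measurable [measurable]:
  "(kern_k :: 'a::euclidean_space \<Rightarrow> real) \<in> borel_measurable borel"
  "(kern_j :: 'a::euclidean_space \<Rightarrow> real) \<in> borel_measurable borel"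
  unfolding kern_k_def[abs_def] kern_j_def[abs_def]
  by (intro borel_measurable_divide borel_measurable_indicator borel_measurable_power
      borel_measurable_norm measurable_ident; simp)+

lemma kern_k_nonneg [simp]: "0 \<le> kern_k z" and kern_j_nonneg [simp]: "0 \<le> kern_j z"
  by (simp_all add: kern_k_def kern_j_def)

lemma kern_k_minus: "kern_k (- z) = kern_k z"
  by (auto simp: kern_k_def indicator_def)

lemma kern_j_le_1: "kern_j (z::'a::euclidean_space) \<le> 1"
proof (cases "norm z < 1")
  case False
  then have "1 \<le> norm z ^ DIM('a)" by (intro one_le_power) simp
  then show ?thesis by (auto simp: kern_j_def indicator_def divide_simps)
qed (simp add: kern_j_def)

lemma c_const_pos: "0 < c_const TYPE('a::euclidean_space)"
  by (simp add: c_const_def Gamma_real_pos)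

definition ip :: "('a::euclidean_space \<Rightarrow> real) \<Rightarrow> ('a \<Rightarrow> real) \<Rightarrow> real" where
  "ip u v = (LINT x|lborel. u x * v x)"

abbreviation mass :: "('a::euclidean_space \<Rightarrow> real) \<Rightarrow> real" where
  "mass u \<equiv> ip u u"

definition form_J :: "('a::euclidean_space \<Rightarrow> real) \<Rightarrow> ('a \<Rightarrow> real) \<Rightarrow> real" where
  "form_J u v = (LINT (x, y)|(lborel \<Otimes>\<^sub>M lborel). u x * v y * kern_j (x - y))"

abbreviation ppart :: "('a \<Rightarrow> real) \<Rightarrow> 'a \<Rightarrow> real" where
  "ppart u \<equiv> \<lambda>x. max (u x) 0"

lemma form_EL_eq:
  "form_EL u v = form_E u v - c_const TYPE('a) * form_J u v + rho_const TYPE('a) * ip u v"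
  for u v :: "'a::euclidean_space \<Rightarrow> real"
  by (simp add: form_EL_def form_J_def ip_def)

lemma form_E_nonneg: "0 \<le> form_E u u" for u :: "'a::euclidean_space \<Rightarrow> real"
  unfolding form_E_def using c_const_pos[where 'a='a]
  by (intro mult_nonneg_nonneg Bochner_Integration.integral_nonneg) (auto split: prod.splits)

lemma mass_nonneg: "0 \<le> mass u"
  unfolding ip_def by (intro Bochner_Integration.integral_nonneg) auto

lemma norm_H_square: "(norm_H u)\<^sup>2 = form_E u u"
  by (simp add: norm_H_def form_E_nonneg)

locale bounded_open =
  fixes \<Omega> :: "'a::euclidean_space set"
  assumes open_dom: "open \<Omega>" and bounded_dom: "bounded \<Omega>"
begin

lemma dom_measurable [measurable]: "\<Omega> \<in> sets borel"
  using open_dom by simp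

lemma dom_finite: "emeasure lborel \<Omega> < \<infinity>"
  using emeasure_bounded_finite[OF bounded_dom] by simp

lemma HH_iff:
  "u \<in> HH \<Omega> \<longleftrightarrow> u \<in> borel_measurable borel \<and> (\<forall>x. x \<notin> \<Omega> \<longrightarrow> u x = 0) \<and>
    integrable lborel (\<lambda>x. u x * u x) \<and>
    integrable (lborel \<Otimes>\<^sub>M lborel) (\<lambda>(x, y). (u x - u y) * (u x - u y) * kern_k (x - y))"
proof -
  have "set_integrable lborel \<Omega> (\<lambda>x. (u x)\<^sup>2) \<longleftrightarrow> integrable lborel (\<lambda>x. u x * u x)"
    if "\<forall>x. x \<notin> \<Omega> \<longrightarrow> u x = 0"
    unfolding set_integrable_def
    by (intro Bochner_Integration.integrable_cong)
       (use that in \<open>auto simp: indicator_def power2_eq_square\<close>)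
  then show ?thesis
    unfolding HH_def by (auto simp: power2_eq_square)
qed

lemma HH_D:
  assumes "u \<in> HH \<Omega>"
  shows HH_measurable: "u \<in> borel_measurable borel" and HH_outside: "\<And>x. x \<notin> \<Omega> \<Longrightarrow> u x = 0"
    and HH_square: "integrable lborel (\<lambda>x. u x * u x)"
    and HH_energy: "integrable (lborel \<Otimes>\<^sub>M lborel) (\<lambda>(x, y). (u x - u y) * (u x - u y) * kern_k (x - y))"
  using assms by (auto simp: HH_iff)

lemma product_le_squares: "\<bar>a * b\<bar> \<le> a * a + b * b" for a b :: real
proof -
  have "0 \<le> (\<bar>a\<bar> - \<bar>b\<bar>)\<^sup>2" by simp
  then have "2 * \<bar>a * b\<bar> \<le> a * a + b * b" by (simp add: power2_eq_square abs_mult algebra_simps)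
  then show ?thesis using abs_ge_zero[of "a * b"] by linarith
qed

lemma ip_integrable:
  assumes "u \<in> HH \<Omega>" "v \<in> HH \<Omega>"
  shows "integrable lborel (\<lambda>x. u x * v x)"
proof (rule Bochner_Integration.integrable_bound)
  show "integrable lborel (\<lambda>x. u x * u x + v x * v x)"
    using assms by (intro Bochner_Integration.integrable_add HH_square)
  show "(\<lambda>x. u x * v x) \<in> borel_measurable lborel"
    using assms[THEN HH_measurable] by measurable
qed (use product_le_squares in auto)

lemma HH_integrable:
  assumes "u \<in> HH \<Omega>" shows "integrable lborel u"
proof (rule Bochner_Integration.integrable_bound)
  show "integrable lborel (\<lambda>x. u x * u x + indicator \<Omega> x)"
    using assms dom_finite
    by (intro Bochner_Integration.integrable_add HH_square) (auto simp: integrable_indicator_iff)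
  show "u \<in> borel_measurable lborel"
    using assms[THEN HH_measurable] by measurable
  have "\<bar>u x\<bar> \<le> u x * u x + indicator \<Omega> x" for x
    using product_le_squares[of "u x" 1] HH_outside[OF assms, of x] by (cases "x \<in> \<Omega>") auto
  then show "AE x in lborel. norm (u x) \<le> norm (u x * u x + indicator \<Omega> x)"
    by fastforce
qed

lemma form_E_integrable:
  assumes "u \<in> HH \<Omega>" "v \<in> HH \<Omega>"
  shows "integrable (lborel \<Otimes>\<^sub>M lborel) (\<lambda>(x, y). (u x - u y) * (v x - v y) * kern_k (x - y))"
proof (rule Bochner_Integration.integrable_bound)
  have [measurable]: "u \<in> borel_measurable borel" "v \<in> borel_measurable borel"
    using assms by (auto dest: HH_measurable)
  show "integrable (lborel \<Otimes>\<^sub>M lborel) (\<lambda>p. (case p of (x, y) \<Rightarrow> (u x - u y) * (u x - u y) * kern_k (x - y))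
     + (case p of (x, y) \<Rightarrow> (v x - v y) * (v x - v y) * kern_k (x - y)))"
    using assms by (intro Bochner_Integration.integrable_add HH_energy)
  show "(\<lambda>(x, y). (u x - u y) * (v x - v y) * kern_k (x - y)) \<in> borel_measurable (lborel \<Otimes>\<^sub>M lborel)"
    by measurable
  have "\<bar>(u x - u y) * (v x - v y) * kern_k (x - y)\<bar> \<le>
      ((u x - u y) * (u x - u y) + (v x - v y) * (v x - v y)) * kern_k (x - y)" for x y
    unfolding abs_mult[of _ "kern_k (x - y)"] abs_of_nonneg[OF kern_k_nonneg]
    by (intro mult_right_mono product_le_squares) simp
  then show "AE p in lborel \<Otimes>\<^sub>M lborel. norm (case p of (x, y) \<Rightarrow> (u x - u y) * (v x - v y) * kern_k (x - y))
     \<le> norm ((case p of (x, y) \<Rightarrow> (u x - u y) * (u x - u y) * kern_k (x - y))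
     + (case p of (x, y) \<Rightarrow> (v x - v y) * (v x - v y) * kern_k (x - y)))"
    by (intro AE_I2) (auto simp: distrib_right split: prod.splits)
qed

lemma form_J_integrable:
  assumes "u \<in> HH \<Omega>" "v \<in> HH \<Omega>"
  shows "integrable (lborel \<Otimes>\<^sub>M lborel) (\<lambda>(x, y). u x * v y * kern_j (x - y))"
proof (rule Bochner_Integration.integrable_bound)
  have [measurable]: "u \<in> borel_measurable borel" "v \<in> borel_measurable borel"
    using assms by (auto dest: HH_measurable)
  show "integrable (lborel \<Otimes>\<^sub>M lborel) (\<lambda>(x, y). u x * v y)"
    using assms by (intro integrable_tensor HH_integrable)
  show "(\<lambda>(x, y). u x * v y * kern_j (x - y)) \<in> borel_measurable (lborel \<Otimes>\<^sub>M lborel)"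
    by measurable
  show "AE p in lborel \<Otimes>\<^sub>M lborel. norm (case p of (x, y) \<Rightarrow> u x * v y * kern_j (x - y))
     \<le> norm (case p of (x, y) \<Rightarrow> u x * v y)"
    by (intro AE_I2) (auto simp: abs_mult intro!: mult_left_le kern_j_le_1 split: prod.splits)
qed

lemma HH_combination:
  assumes u: "u \<in> HH \<Omega>" and v: "v \<in> HH \<Omega>"
  shows "(\<lambda>x. a * u x + b * v x) \<in> HH \<Omega>"
proof -
  let ?w = "\<lambda>x. a * u x + b * v x"
  have [measurable]: "u \<in> borel_measurable borel" "v \<in> borel_measurable borel"
    using assms by (auto dest: HH_measurable)
  have "integrable lborel (\<lambda>x. a * a * (u x * u x) + 2 * a * b * (u x * v x) + b * b * (v x * v x))"
    using ip_integrable[OF u u] ip_integrable[OF u v] ip_integrable[OF v v] by simp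
  moreover have "(\<lambda>x. a * a * (u x * u x) + 2 * a * b * (u x * v x) + b * b * (v x * v x)) =
      (\<lambda>x. ?w x * ?w x)" by (auto simp: algebra_simps)
  moreover
  have "integrable (lborel \<Otimes>\<^sub>M lborel) (\<lambda>p.
     a * a * (case p of (x, y) \<Rightarrow> (u x - u y) * (u x - u y) * kern_k (x - y)) +
     2 * a * b * (case p of (x, y) \<Rightarrow> (u x - u y) * (v x - v y) * kern_k (x - y)) +
     b * b * (case p of (x, y) \<Rightarrow> (v x - v y) * (v x - v y) * kern_k (x - y)))"
    using form_E_integrable[OF u u] form_E_integrable[OF u v] form_E_integrable[OF v v] by simp
  moreover have "(\<lambda>p.
     a * a * (case p of (x, y) \<Rightarrow> (u x - u y) * (u x - u y) * kern_k (x - y)) +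
     2 * a * b * (case p of (x, y) \<Rightarrow> (u x - u y) * (v x - v y) * kern_k (x - y)) +
     b * b * (case p of (x, y) \<Rightarrow> (v x - v y) * (v x - v y) * kern_k (x - y))) =
     (\<lambda>(x, y). (?w x - ?w y) * (?w x - ?w y) * kern_k (x - y))"
    by (auto simp: algebra_simps)
  ultimately show ?thesis
    using HH_outside[OF u] HH_outside[OF v] unfolding HH_iff by auto
qed

lemma HH_diff: "u \<in> HH \<Omega> \<Longrightarrow> v \<in> HH \<Omega> \<Longrightarrow> (\<lambda>x. u x - v x) \<in> HH \<Omega>"
  using HH_combination[of u v 1 "-1"] by simp

lemma HH_uminus: "u \<in> HH \<Omega> \<Longrightarrow> (\<lambda>x. - u x) \<in> HH \<Omega>"
  using HH_combination[of u u "-1" 0] by simp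

text \<open>
Post-composition with a normal contraction increases no difference, and hence not the energy. It
is applied to the positive part and to the absolute value.
\<close>

lemma HH_contraction:
  fixes g :: "real \<Rightarrow> real"
  assumes u: "u \<in> HH \<Omega>" and [measurable]: "g \<in> borel_measurable borel"
    and g0: "g 0 = 0" and g: "\<And>s t. \<bar>g s - g t\<bar> \<le> \<bar>s - t\<bar>"
  shows "(\<lambda>x. g (u x)) \<in> HH \<Omega>"
proof -
  have [measurable]: "u \<in> borel_measurable borel" using u by (rule HH_measurable)
  have sq: "a * a \<le> b * b" if "\<bar>a\<bar> \<le> \<bar>b\<bar>" for a b :: real
    using that by (metis abs_le_square_iff power2_eq_square)
  have "integrable lborel (\<lambda>x. g (u x) * g (u x))"
    by (rule Bochner_Integration.integrable_bound[OF HH_square[OF u]])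
       (use sq g[of _ 0] g0 in \<open>auto simp: abs_mult\<close>)
  moreover have "integrable (lborel \<Otimes>\<^sub>M lborel)
      (\<lambda>(x, y). (g (u x) - g (u y)) * (g (u x) - g (u y)) * kern_k (x - y))"
    by (rule Bochner_Integration.integrable_bound[OF HH_energy[OF u]])
       (use sq g in \<open>auto intro!: AE_I2 mult_right_mono simp: abs_mult\<close>)
  ultimately show ?thesis
    using HH_outside[OF u] g0 unfolding HH_iff by auto
qed

lemma HH_ppart: "u \<in> HH \<Omega> \<Longrightarrow> ppart u \<in> HH \<Omega>"
  by (rule HH_contraction) auto

lemma HH_abs: "u \<in> HH \<Omega> \<Longrightarrow> (\<lambda>x. \<bar>u x\<bar>) \<in> HH \<Omega>"
  by (rule HH_contraction) auto

lemma form_E_expand: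
  assumes u: "u \<in> HH \<Omega>" and v: "v \<in> HH \<Omega>"
  shows "form_E (\<lambda>x. a * u x + b * v x) (\<lambda>x. a * u x + b * v x) =
    a\<^sup>2 * form_E u u + a * b * (form_E u v + form_E v u) + b\<^sup>2 * form_E v v"
proof -
  have "(LINT (x, y)|(lborel \<Otimes>\<^sub>M lborel). (a * u x + b * v x - (a * u y + b * v y)) *
      (a * u x + b * v x - (a * u y + b * v y)) * kern_k (x - y)) =
    (LINT p|(lborel \<Otimes>\<^sub>M lborel).
     a\<^sup>2 * (case p of (x, y) \<Rightarrow> (u x - u y) * (u x - u y) * kern_k (x - y)) +
     (a * b * (case p of (x, y) \<Rightarrow> (u x - u y) * (v x - v y) * kern_k (x - y)) +
     a * b * (case p of (x, y) \<Rightarrow> (v x - v y) * (u x - u y) * kern_k (x - y))) +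
     b\<^sup>2 * (case p of (x, y) \<Rightarrow> (v x - v y) * (v x - v y) * kern_k (x - y)))"
    by (intro Bochner_Integration.integral_cong) (auto simp: algebra_simps power2_eq_square)
  also have "\<dots> = a\<^sup>2 * (LINT (x, y)|(lborel \<Otimes>\<^sub>M lborel). (u x - u y) * (u x - u y) * kern_k (x - y)) +
     (a * b * (LINT (x, y)|(lborel \<Otimes>\<^sub>M lborel). (u x - u y) * (v x - v y) * kern_k (x - y)) +
     a * b * (LINT (x, y)|(lborel \<Otimes>\<^sub>M lborel). (v x - v y) * (u x - u y) * kern_k (x - y))) +
     b\<^sup>2 * (LINT (x, y)|(lborel \<Otimes>\<^sub>M lborel). (v x - v y) * (v x - v y) * kern_k (x - y))"
    using form_E_integrable[OF u u] form_E_integrable[OF u v] form_E_integrable[OF v u]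
      form_E_integrable[OF v v]
    by simp
  finally show ?thesis by (simp add: form_E_def algebra_simps)
qed

lemma form_J_expand:
  assumes u: "u \<in> HH \<Omega>" and v: "v \<in> HH \<Omega>"
  shows "form_J (\<lambda>x. a * u x + b * v x) (\<lambda>x. a * u x + b * v x) =
    a\<^sup>2 * form_J u u + a * b * (form_J u v + form_J v u) + b\<^sup>2 * form_J v v"
proof -
  have "(LINT (x, y)|(lborel \<Otimes>\<^sub>M lborel). (a * u x + b * v x) *
      (a * u y + b * v y) * kern_j (x - y)) =
    (LINT p|(lborel \<Otimes>\<^sub>M lborel).
     a\<^sup>2 * (case p of (x, y) \<Rightarrow> u x * u y * kern_j (x - y)) +
     (a * b * (case p of (x, y) \<Rightarrow> u x * v y * kern_j (x - y)) +
     a * b * (case p of (x, y) \<Rightarrow> v x * u y * kern_j (x - y))) +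
     b\<^sup>2 * (case p of (x, y) \<Rightarrow> v x * v y * kern_j (x - y)))"
    by (intro Bochner_Integration.integral_cong) (auto simp: algebra_simps power2_eq_square)
  also have "\<dots> = a\<^sup>2 * (LINT (x, y)|(lborel \<Otimes>\<^sub>M lborel). u x * u y * kern_j (x - y)) +
     (a * b * (LINT (x, y)|(lborel \<Otimes>\<^sub>M lborel). u x * v y * kern_j (x - y)) +
     a * b * (LINT (x, y)|(lborel \<Otimes>\<^sub>M lborel). v x * u y * kern_j (x - y))) +
     b\<^sup>2 * (LINT (x, y)|(lborel \<Otimes>\<^sub>M lborel). v x * v y * kern_j (x - y))"
    using form_J_integrable[OF u u] form_J_integrable[OF u v] form_J_integrable[OF v u]
      form_J_integrable[OF v v]
    by simp
  finally show ?thesis by (simp add: form_J_def algebra_simps)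
qed

lemma ip_commute: "ip u v = ip v u"
  by (simp add: ip_def mult.commute)

lemma ip_combination:
  assumes "u \<in> HH \<Omega>" "v \<in> HH \<Omega>" "w \<in> HH \<Omega>"
  shows "ip (\<lambda>x. a * u x + b * v x) w = a * ip u w + b * ip v w"
  using ip_integrable[OF assms(1,3)] ip_integrable[OF assms(2,3)]
  by (simp add: ip_def distrib_right mult.assoc)

lemma mass_expand:
  assumes u: "u \<in> HH \<Omega>" and v: "v \<in> HH \<Omega>"
  shows "mass (\<lambda>x. a * u x + b * v x) = a\<^sup>2 * mass u + 2 * a * b * ip u v + b\<^sup>2 * mass v"
proof -
  let ?w = "\<lambda>x. a * u x + b * v x"
  have "mass ?w = a * ip u ?w + b * ip v ?w"
    using HH_combination[OF assms] by (rule ip_combination[OF assms])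
  moreover have "ip u ?w = a * ip u u + b * ip u v" "ip v ?w = a * ip u v + b * ip v v"
    using ip_combination[OF u v u, of a b] ip_combination[OF u v v, of a b]
    by (simp_all add: ip_commute[of _ ?w] ip_commute[of v u])
  ultimately show ?thesis by (simp add: power2_eq_square algebra_simps)
qed

lemma form_EL_expand:
  assumes u: "u \<in> HH \<Omega>" and v: "v \<in> HH \<Omega>"
  shows "form_EL (\<lambda>x. a * u x + b * v x) (\<lambda>x. a * u x + b * v x) =
    a\<^sup>2 * form_EL u u + a * b * (form_EL u v + form_EL v u) + b\<^sup>2 * form_EL v v"
  unfolding form_EL_eq form_E_expand[OF assms] form_J_expand[OF assms] mass_expand[OF assms]
  by (simp add: algebra_simps ip_commute[of v u])

text \<open>
The expressions with \<open>b\<close> and with \<open>- b\<close> add up to the right-hand side, and the second is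
nonnegative.
\<close>

lemma form_E_add_le:
  assumes u: "u \<in> HH \<Omega>" and v: "v \<in> HH \<Omega>"
  shows "form_E (\<lambda>x. a * u x + b * v x) (\<lambda>x. a * u x + b * v x) \<le>
    2 * a\<^sup>2 * form_E u u + 2 * b\<^sup>2 * form_E v v"
  using form_E_expand[OF u v, of a b] form_E_expand[OF u v, of a "-b"]
    form_E_nonneg[of "\<lambda>x. a * u x + (- b) * v x"]
  by (simp add: mult.commute mult.left_commute)

lemma ip_le_young:
  assumes u: "u \<in> HH \<Omega>" and v: "v \<in> HH \<Omega>" and "0 < t"
  shows "2 * \<bar>ip u v\<bar> \<le> t * mass u + mass v / t"
proof -
  let ?s = "sqrt t"
  have s: "?s > 0" "?s * ?s = t" "?s\<^sup>2 = t" using assms by auto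
  have "0 \<le> mass (\<lambda>x. ?s * u x + (1 / ?s) * v x)" "0 \<le> mass (\<lambda>x. ?s * u x + (- 1 / ?s) * v x)"
    by (rule mass_nonneg)+
  then show ?thesis
    unfolding mass_expand[OF u v] using s assms(3) by (simp add: power_divide)
qed

lemma ip_le_1:
  assumes u: "u \<in> HH \<Omega>" and v: "v \<in> HH \<Omega>" and "mass v \<le> 1"
  shows "\<bar>ip u v\<bar> \<le> sqrt (mass u)"
proof -
  have "2 * \<bar>ip u v\<bar> \<le> 2 * (sqrt (mass u) + e)" if "e > 0" for e
  proof -
    let ?q = "sqrt (mass u) + e"
    have q: "?q > 0" using that mass_nonneg[of u] by (simp add: add_nonneg_pos)
    have "mass u \<le> ?q\<^sup>2"
      using mass_nonneg[of u] that by (simp add: power2_sum)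
    then have "(1 / ?q) * mass u \<le> ?q"
      using q by (simp add: divide_simps power2_eq_square)
    moreover have "mass v / (1 / ?q) \<le> ?q"
      using q assms(3) mult_right_mono[of "mass v" 1 ?q] by simp
    ultimately have "(1 / ?q) * mass u + mass v / (1 / ?q) \<le> ?q + ?q"
      by (rule add_mono)
    moreover have "2 * \<bar>ip u v\<bar> \<le> (1 / ?q) * mass u + mass v / (1 / ?q)"
      using q by (intro ip_le_young[OF u v]) simp
    ultimately have "2 * \<bar>ip u v\<bar> \<le> ?q + ?q" by (rule order_trans[rotated])
    then show ?thesis by simp
  qed
  then show ?thesis by (meson field_le_epsilon mult_le_cancel_left_pos zero_less_numeral)
qed

lemma L1_square_le_mass:
  assumes u: "u \<in> HH \<Omega>"
  shows "(LINT x|lborel. \<bar>u x\<bar>)\<^sup>2 \<le> measure lborel \<Omega> * mass u"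
proof -
  let ?V = "measure lborel \<Omega>" and ?I = "LINT x|lborel. \<bar>u x\<bar>"
  have int: "integrable lborel (\<lambda>x. \<bar>u x\<bar>)" "integrable lborel (indicator \<Omega> :: 'a \<Rightarrow> real)"
    using HH_integrable[OF u] dom_finite by (auto simp: integrable_indicator_iff)
  have main: "2 * ?I \<le> t * mass u + ?V / t" if "t > 0" for t
  proof -
    have "2 * \<bar>u x\<bar> \<le> t * (u x * u x) + indicator \<Omega> x / t" for x
    proof (cases "x \<in> \<Omega>")
      case True
      have "0 \<le> (t * \<bar>u x\<bar> - 1)\<^sup>2" by simp
      then show ?thesis using that True
        by (simp add: power2_eq_square field_simps)
    qed (use HH_outside[OF u] in auto)
    then have "(LINT x|lborel. 2 * \<bar>u x\<bar>) \<le> (LINT x|lborel. t * (u x * u x) + indicator \<Omega> x / t)"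
      using int HH_square[OF u] by (intro integral_mono) auto
    also have "\<dots> = t * mass u + ?V / t"
      using int HH_square[OF u] by (simp add: ip_def)
    finally show ?thesis by simp
  qed
  have I0: "?I \<ge> 0" and V0: "?V \<ge> 0" by auto
  show ?thesis
  proof (cases "?I = 0")
    case False
    then have I: "?I > 0" using I0 by linarith
    have V: "?V > 0"
    proof (rule ccontr)
      assume "\<not> ?V > 0"
      then have V: "?V = 0" using V0 by linarith
      have "2 * ?I \<le> ?I / (mass u + 1) * mass u"
        using main[of "?I / (mass u + 1)"] I mass_nonneg[of u] V by (simp add: divide_simps)
      also have "\<dots> \<le> ?I" using I mass_nonneg[of u] by (simp add: field_simps)
      finally show False using I by simp
    qed
    show ?thesis using main[of "?V / ?I"] V I by (simp add: field_simps power2_eq_square)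
  qed (use V0 mass_nonneg[of u] in simp)
qed

lemma form_J_bound:
  assumes u: "u \<in> HH \<Omega>"
  shows "\<bar>form_J u u\<bar> \<le> measure lborel \<Omega> * mass u"
proof -
  have "\<bar>form_J u u\<bar> \<le> (LINT (x, y)|(lborel \<Otimes>\<^sub>M lborel). \<bar>u x\<bar> * \<bar>u y\<bar>)"
    unfolding form_J_def
    using form_J_integrable[OF u u] HH_integrable[OF u]
    by (intro integral_abs_bound_integral integrable_tensor)
       (auto simp: abs_mult intro!: mult_left_le kern_j_le_1)
  also have "\<dots> = (LINT x|lborel. \<bar>u x\<bar>)\<^sup>2"
    using HH_integrable[OF u] by (simp add: integrable_tensor power2_eq_square)
  finally show ?thesis using L1_square_le_mass[OF u] by simp
qed

text \<open>
The terms of \<open>form_EL\<close> other than \<open>form_E\<close> are bounded in \<open>L\<^sup>2\<close> with this constant.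
\<close>

definition EL_defect :: real where
  "EL_defect = c_const TYPE('a) * measure lborel \<Omega> + \<bar>rho_const TYPE('a)\<bar>"

lemma EL_defect_nonneg: "0 \<le> EL_defect"
  unfolding EL_defect_def using c_const_pos[where 'a='a] by simp

lemma form_EL_form_E:
  assumes u: "u \<in> HH \<Omega>"
  shows "\<bar>form_EL u u - form_E u u\<bar> \<le> EL_defect * mass u"
proof -
  have "\<bar>c_const TYPE('a) * form_J u u\<bar> \<le> c_const TYPE('a) * (measure lborel \<Omega> * mass u)"
    using c_const_pos[where 'a='a] form_J_bound[OF u] by (simp add: abs_mult)
  moreover have "\<bar>rho_const TYPE('a) * mass u\<bar> = \<bar>rho_const TYPE('a)\<bar> * mass u"
    using mass_nonneg[of u] by (simp add: abs_mult)
  ultimately show ?thesis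
    unfolding form_EL_eq EL_defect_def by (simp add: distrib_right mult.assoc)
qed

end

section \<open>The singular kernel on dyadic shells\<close>

text \<open>
On a dyadic shell the kernel \<open>\<bar>z\<bar>\<^sup>-\<^sup>N\<close> is comparable to the inverse volume of the shell. So each
shell contributes the same amount to its integral, which therefore diverges logarithmically at the
origin, whereas the integral of \<open>\<bar>z\<bar>\<^sup>2 \<bar>z\<bar>\<^sup>-\<^sup>N\<close> becomes a geometric series.
\<close>

definition shell :: "nat \<Rightarrow> 'a::euclidean_space set" where
  "shell i = ball 0 ((1/2) ^ i) - ball 0 ((1/2) ^ Suc i)"

definition trunc_kern :: "nat \<Rightarrow> 'a::euclidean_space \<Rightarrow> real" where
  "trunc_kern n z = indicator (- ball 0 ((1/2) ^ n)) z * kern_k z"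

lemma shell_measurable [measurable]: "shell i \<in> sets borel"
  by (simp add: shell_def)

lemma trunc_kern_measurable [measurable]:
  "(trunc_kern n :: 'a::euclidean_space \<Rightarrow> real) \<in> borel_measurable borel"
proof -
  have [measurable]: "- ball 0 ((1/2) ^ n) \<in> sets (borel :: 'a measure)" by simp
  show ?thesis unfolding trunc_kern_def[abs_def] by measurable
qed

lemma trunc_kern_nonneg [simp]: "0 \<le> trunc_kern n z"
  by (simp add: trunc_kern_def)

lemma trunc_kern_le: "trunc_kern n z \<le> kern_k z"
  by (auto simp: trunc_kern_def indicator_def)

lemma trunc_kern_minus: "trunc_kern n (- z) = trunc_kern n z"
  by (auto simp: trunc_kern_def indicator_def kern_k_minus)

lemma emeasure_shell:
  "emeasure lborel (shell i :: 'a::euclidean_space set) =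
    ennreal (unit_ball_vol (real DIM('a)) * ((1/2) ^ i) ^ DIM('a) * (1 - (1/2) ^ DIM('a)))"
proof -
  have sub: "ball 0 ((1/2) ^ Suc i) \<subseteq> (ball 0 ((1/2) ^ i) :: 'a set)"
    by (intro subset_ball power_decreasing) auto
  have "emeasure lborel (shell i :: 'a set) =
      emeasure lborel (ball 0 ((1/2) ^ i) :: 'a set) - emeasure lborel (ball 0 ((1/2) ^ Suc i) :: 'a set)"
    unfolding shell_def by (rule emeasure_Diff) (use sub in \<open>auto simp: emeasure_ball\<close>)
  also have "\<dots> = ennreal (unit_ball_vol (real DIM('a)) * ((1/2) ^ i) ^ DIM('a)
      - unit_ball_vol (real DIM('a)) * ((1/2) ^ Suc i) ^ DIM('a))"
    by (subst (1 2) emeasure_ball) (auto simp: ennreal_minus)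
  finally show ?thesis
    by (simp only: power_Suc power_mult_distrib right_diff_distrib left_diff_distrib
        mult_1_left mult_1_right mult_ac)
qed

lemma kern_k_shell_ge:
  assumes "z \<in> (shell i :: 'a::euclidean_space set)"
  shows "((2::real) ^ i) ^ DIM('a) \<le> kern_k z"
proof -
  have "norm z < (1/2) ^ i" and "(1/2) ^ Suc i \<le> norm z"
    using assms by (auto simp: shell_def)
  moreover have "(0::real) < (1/2) ^ Suc i" by simp
  ultimately have z: "norm z < (1/2) ^ i" "norm z > 0" by linarith+
  moreover have "(1/2::real) ^ i \<le> 1" by (intro power_le_one) auto
  ultimately have "norm z < 1" by linarith
  then have "kern_k z = (1 / norm z) ^ DIM('a)"
    by (simp add: kern_k_def indicator_def power_one_over field_simps)
  moreover have "2 ^ i \<le> 1 / norm z"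
    using z by (simp add: field_simps power_one_over)
  ultimately show ?thesis by (simp add: power_mono)
qed

lemma kern_k_le_off_ball:
  fixes z :: "'a::euclidean_space"
  assumes "z \<in> - ball 0 ((1/2) ^ i)"
  shows "kern_k z \<le> ((2::real) ^ i) ^ DIM('a)"
proof -
  have "(1/2) ^ i \<le> norm z" using assms by auto
  moreover have "(0::real) < (1/2) ^ i" by simp
  ultimately have "0 < norm z" "1 / norm z \<le> 2 ^ i"
    by (linarith, simp add: field_simps power_one_over) (smt (verit) \<open>(1/2) ^ i \<le> norm z\<close> \<open>0 < (1/2) ^ i\<close> divide_le_eq mult.commute pos_divide_le_eq)
  moreover have "kern_k z \<le> (1 / norm z) ^ DIM('a)"
    by (auto simp: kern_k_def indicator_def power_one_over field_simps)
  ultimately show ?thesis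
    by (meson order_trans power_mono divide_nonneg_nonneg norm_ge_zero zero_le_one)
qed

lemma trunc_kern_bound: "trunc_kern n z \<le> ((2::real) ^ n) ^ DIM('a)" for z :: "'a::euclidean_space"
  using kern_k_le_off_ball[of z n] by (auto simp: trunc_kern_def indicator_def)

text \<open>
Passing from \<open>n\<close> to \<open>n + 1\<close> adds the shell number \<open>n\<close>. It contributes the volume of the unit
ball times \<open>1 - 2\<^sup>-\<^sup>N\<close>, which is at least one half of that volume in every dimension.
\<close>

lemma nn_integral_trunc_kern_ge:
  "ennreal (real n * (unit_ball_vol (real DIM('a)) / 2)) \<le>
    (\<integral>\<^sup>+ z. ennreal (trunc_kern n (z::'a::euclidean_space)) \<partial>lborel)"
proof (induction n)
  case (Suc n)
  let ?V = "unit_ball_vol (real DIM('a))" and ?a = "((2::real) ^ n) ^ DIM('a)"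
  have le: "trunc_kern n z + ?a * indicator (shell n) z \<le> trunc_kern (Suc n) z" for z :: 'a
  proof (cases "z \<in> shell n")
    case True
    then show ?thesis using kern_k_shell_ge[OF True]
      by (auto simp: trunc_kern_def shell_def indicator_def)
  next
    case False
    have "ball 0 ((1/2) ^ Suc n) \<subseteq> (ball 0 ((1/2) ^ n) :: 'a set)"
      by (intro subset_ball power_decreasing) auto
    with False show ?thesis by (auto simp: trunc_kern_def indicator_def)
  qed
  have half: "(1/2::real) ^ DIM('a) \<le> 1/2"
    using power_decreasing[of 1 "DIM('a)" "1/2::real"] by simp
  have "?V / 2 \<le> ?V * (1 - (1/2) ^ DIM('a))"
    using mult_left_mono[OF half, of ?V] by (simp add: right_diff_distrib)
  also have "\<dots> = ?a * (?V * ((1/2) ^ n) ^ DIM('a) * (1 - (1/2) ^ DIM('a)))"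
    by (simp add: power_one_over field_simps)
  finally have "ennreal (?V / 2) \<le> ennreal ?a * emeasure lborel (shell n :: 'a set)"
    unfolding emeasure_shell by (subst ennreal_mult[symmetric]) (auto intro!: ennreal_leI mult_nonneg_nonneg power_le_one)
  also have "\<dots> = (\<integral>\<^sup>+ z. ennreal (?a * indicator (shell n) (z::'a)) \<partial>lborel)"
    by (simp add: ennreal_mult ennreal_indicator nn_integral_cmult)
  finally have "ennreal (real n * (?V / 2)) + ennreal (?V / 2) \<le>
      (\<integral>\<^sup>+ z. ennreal (trunc_kern n (z::'a)) \<partial>lborel) +
      (\<integral>\<^sup>+ z. ennreal (?a * indicator (shell n) (z::'a)) \<partial>lborel)"
    by (intro add_mono Suc.IH)
  also have "\<dots> = (\<integral>\<^sup>+ z. ennreal (trunc_kern n (z::'a)) + ennreal (?a * indicator (shell n) z) \<partial>lborel)"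
    by (intro nn_integral_add[symmetric]) auto
  also have "\<dots> \<le> (\<integral>\<^sup>+ z. ennreal (trunc_kern (Suc n) (z::'a)) \<partial>lborel)"
    by (intro nn_integral_mono) (simp add: ennreal_plus[symmetric] ennreal_leI le del: ennreal_plus)
  finally show ?case
    by (simp add: ennreal_plus[symmetric] algebra_simps add_divide_distrib del: ennreal_plus)
qed simp

lemma nn_integral_translate:
  fixes f :: "'a::euclidean_space \<Rightarrow> ennreal"
  assumes [measurable]: "f \<in> borel_measurable borel"
  shows "(\<integral>\<^sup>+ y. f (x + y) \<partial>lborel) = (\<integral>\<^sup>+ y. f y \<partial>lborel)"
  by (subst (2) lborel_distr_plus[symmetric, of x]) (simp add: nn_integral_distr)

lemma nn_integral_translate_right:
  fixes f :: "'a::euclidean_space \<Rightarrow> ennreal"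
  assumes "f \<in> borel_measurable borel"
  shows "(\<integral>\<^sup>+ y. f (y + x) \<partial>lborel) = (\<integral>\<^sup>+ y. f y \<partial>lborel)"
  using nn_integral_translate[OF assms, of x] by (simp add: add.commute)

lemma nn_integral_tensor_kernel:
  fixes f K :: "'a::euclidean_space \<Rightarrow> ennreal"
  assumes [measurable]: "f \<in> borel_measurable borel" "K \<in> borel_measurable borel"
    and K: "\<And>z. K (- z) = K z"
  shows "(\<integral>\<^sup>+ (x, y). f x * K (x - y) \<partial>(lborel \<Otimes>\<^sub>M lborel)) = (\<integral>\<^sup>+ x. f x \<partial>lborel) * (\<integral>\<^sup>+ z. K z \<partial>lborel)"
proof -
  have "(\<integral>\<^sup>+ (x, y). f x * K (x - y) \<partial>(lborel \<Otimes>\<^sub>M lborel)) =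
      (\<integral>\<^sup>+ x. (\<integral>\<^sup>+ y. f x * K (x - y) \<partial>lborel) \<partial>lborel)"
    by (subst lborel.nn_integral_fst[symmetric]) auto
  also have "\<dots> = (\<integral>\<^sup>+ x. f x * (\<integral>\<^sup>+ z. K z \<partial>lborel) \<partial>lborel)"
  proof (intro nn_integral_cong)
    fix x
    have "(\<integral>\<^sup>+ y. f x * K (x - y) \<partial>lborel) = f x * (\<integral>\<^sup>+ y. K (- x + y) \<partial>lborel)"
      using K[of "x - _"] by (simp add: nn_integral_cmult)
    then show "(\<integral>\<^sup>+ y. f x * K (x - y) \<partial>lborel) = f x * (\<integral>\<^sup>+ z. K z \<partial>lborel)"
      by (simp only: nn_integral_translate assms)
  qed
  finally show ?thesis by (simp add: nn_integral_multc)
qed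

lemma in_some_shell:
  fixes z :: "'a::euclidean_space"
  assumes "0 < norm z" "norm z < 1" shows "\<exists>i. z \<in> shell i"
proof -
  obtain m where "(1/2) ^ m < norm z" using real_arch_pow_inv[OF assms(1), of "1/2"] by auto
  then have ex: "\<exists>m. (1/2) ^ m \<le> norm z" by (meson less_imp_le)
  define n where "n = (LEAST m. (1/2) ^ m \<le> norm z)"
  have n: "(1/2) ^ n \<le> norm z" unfolding n_def using ex by (rule LeastI_ex)
  have "n \<noteq> 0" using n assms(2) by (intro notI) simp
  then obtain i where i: "n = Suc i" by (cases n) auto
  have "\<not> (1/2) ^ i \<le> norm z" using not_less_Least[of i "\<lambda>m. (1/2) ^ m \<le> norm z"] i by (simp add: n_def)
  with n i have "z \<in> shell i" by (auto simp: shell_def)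
  then show ?thesis ..
qed

lemma second_moment_kern_k_finite:
  "(\<integral>\<^sup>+ z. ennreal ((norm z)\<^sup>2 * kern_k (z::'a::euclidean_space)) \<partial>lborel) < \<infinity>"
proof -
  let ?V = "unit_ball_vol (real DIM('a))"
  define a :: "nat \<Rightarrow> real" where "a i = ((1/2) ^ i)\<^sup>2 * (2 ^ Suc i) ^ DIM('a)" for i
  have a0: "a i \<ge> 0" for i by (simp add: a_def)
  have "(\<integral>\<^sup>+ z. ennreal ((norm z)\<^sup>2 * kern_k (z::'a)) \<partial>lborel) \<le>
      (\<integral>\<^sup>+ z. (\<Sum>i. ennreal (a i) * indicator (shell i) (z::'a)) \<partial>lborel)"
  proof (intro nn_integral_mono)
    fix z :: 'a
    show "ennreal ((norm z)\<^sup>2 * kern_k z) \<le> (\<Sum>i. ennreal (a i) * indicator (shell i) z)"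
    proof (cases "0 < norm z \<and> norm z < 1")
      case True
      then obtain i where i: "z \<in> shell i" using in_some_shell by blast
      have "(norm z)\<^sup>2 * kern_k z \<le> a i"
        unfolding a_def using i
        by (intro mult_mono power_mono kern_k_le_off_ball) (auto simp: shell_def)
      then have "ennreal ((norm z)\<^sup>2 * kern_k z) \<le> (\<Sum>j\<in>{i}. ennreal (a j) * indicator (shell j) z)"
        using i by (simp add: ennreal_leI)
      also have "\<dots> \<le> (\<Sum>j. ennreal (a j) * indicator (shell j) z)"
        by (rule sum_le_suminf) auto
      finally show ?thesis .
    qed (auto simp: kern_k_def)
  qed
  also have "\<dots> = (\<Sum>i. ennreal (a i) * emeasure lborel (shell i :: 'a set))"
    by (subst nn_integral_suminf) (auto simp: nn_integral_cmult)
  also have "\<dots> \<le> (\<Sum>i. ennreal (2 ^ DIM('a) * ?V * (1/4) ^ i))"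
  proof (intro suminf_le allI)
    fix i
    have "a i * (?V * ((1/2) ^ i) ^ DIM('a) * (1 - (1/2) ^ DIM('a))) \<le> a i * (?V * ((1/2) ^ i) ^ DIM('a) * 1)"
      using a0 by (intro mult_left_mono) auto
    also have "\<dots> = 2 ^ DIM('a) * ?V * (1/4) ^ i * (((2 ^ i) * (1/2) ^ i) ^ DIM('a))"
    proof -
      have "((1/2::real) ^ i)\<^sup>2 = ((1/2)\<^sup>2) ^ i" by (simp only: power_mult[symmetric] mult.commute)
      then have q: "((1/2::real) ^ i)\<^sup>2 = (1/4) ^ i" by (simp add: power2_eq_square)
      show ?thesis
        unfolding a_def q by (simp only: power_mult_distrib power_Suc mult_1_right mult_ac)
    qed
    also have "((2::real) ^ i) * (1/2) ^ i = 1" by (simp add: power_mult_distrib[symmetric])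
    finally show "ennreal (a i) * emeasure lborel (shell i :: 'a set) \<le> ennreal (2 ^ DIM('a) * ?V * (1/4) ^ i)"
      unfolding emeasure_shell using a0
      by (subst ennreal_mult[symmetric]) (auto intro!: ennreal_leI mult_nonneg_nonneg power_le_one)
  qed auto
  also have "\<dots> = ennreal (\<Sum>i. 2 ^ DIM('a) * ?V * (1/4) ^ i)"
    by (intro suminf_ennreal2 summable_mult summable_geometric) auto
  also have "\<dots> < \<infinity>" by simp
  finally show ?thesis .
qed

lemma nn_integral_tensor_kernel_snd:
  fixes f K :: "'a::euclidean_space \<Rightarrow> ennreal"
  assumes [measurable]: "f \<in> borel_measurable borel" "K \<in> borel_measurable borel"
  shows "(\<integral>\<^sup>+ (x, y). f y * K (x - y) \<partial>(lborel \<Otimes>\<^sub>M lborel)) = (\<integral>\<^sup>+ x. f x \<partial>lborel) * (\<integral>\<^sup>+ z. K z \<partial>lborel)"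
proof -
  have "(\<integral>\<^sup>+ (x, y). f y * K (x - y) \<partial>(lborel \<Otimes>\<^sub>M lborel)) =
      (\<integral>\<^sup>+ y. (\<integral>\<^sup>+ x. f y * K (x - y) \<partial>lborel) \<partial>lborel)"
    by (subst lborel_pair.nn_integral_snd[symmetric]) auto
  also have "\<dots> = (\<integral>\<^sup>+ y. f y * (\<integral>\<^sup>+ z. K z \<partial>lborel) \<partial>lborel)"
  proof (rule nn_integral_cong)
    fix y
    have "(\<integral>\<^sup>+ x. f y * K (x - y) \<partial>lborel) = f y * (\<integral>\<^sup>+ x. K (x + - y) \<partial>lborel)"
      by (simp add: nn_integral_cmult)
    then show "(\<integral>\<^sup>+ x. f y * K (x - y) \<partial>lborel) = f y * (\<integral>\<^sup>+ z. K z \<partial>lborel)"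
      by (simp only: nn_integral_translate_right assms)
  qed
  finally show ?thesis by (simp add: nn_integral_multc)
qed

context bounded_open
begin

section \<open>Consequences of finite energy\<close>

lemma energy_nn_integral:
  assumes "u \<in> HH \<Omega>"
  shows "(\<integral>\<^sup>+ (x, y). ennreal ((u x - u y) * (u x - u y) * kern_k (x - y)) \<partial>(lborel \<Otimes>\<^sub>M lborel)) =
    ennreal (2 / c_const TYPE('a) * form_E u u)"
proof -
  have "(\<integral>\<^sup>+ (x, y). ennreal ((u x - u y) * (u x - u y) * kern_k (x - y)) \<partial>(lborel \<Otimes>\<^sub>M lborel)) =
     (\<integral>\<^sup>+ p. ennreal (case p of (x, y) \<Rightarrow> (u x - u y) * (u x - u y) * kern_k (x - y)) \<partial>(lborel \<Otimes>\<^sub>M lborel))"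
    by (intro nn_integral_cong) (auto split: prod.splits)
  also have "\<dots> = ennreal (LINT (x, y)|(lborel \<Otimes>\<^sub>M lborel). (u x - u y) * (u x - u y) * kern_k (x - y))"
    using HH_energy[OF assms] by (intro nn_integral_eq_integral) auto
  finally show ?thesis
    using c_const_pos[where 'a='a] by (simp add: form_E_def)
qed

lemma mass_nn_integral:
  assumes "u \<in> HH \<Omega>" shows "(\<integral>\<^sup>+ x. ennreal (u x * u x) \<partial>lborel) = ennreal (mass u)"
  unfolding ip_def using HH_square[OF assms] by (intro nn_integral_eq_integral) auto

text \<open>
Integrate \<open>u(x)\<^sup>2 \<le> (u(x) - u(y))\<^sup>2 + 2 \<bar>u(x)\<bar> \<bar>u(y)\<bar>\<close> against the kernel truncated at
\<open>\<bar>z\<bar> = 2\<^sup>-\<^sup>n\<close>. On the left the mass gets the factor \<open>\<integral> trunc_kern n\<close>, which grows with \<open>n\<close>;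
on the right the first term does not depend on \<open>n\<close>, and the second is bounded because the truncated
kernel is.
\<close>

lemma mass_le_energy_L1:
  assumes u: "u \<in> HH \<Omega>"
  shows "real n * (unit_ball_vol (real DIM('a)) / 2) * mass u \<le>
    2 / c_const TYPE('a) * form_E u u + 2 * (2 ^ n) ^ DIM('a) * (LINT x|lborel. \<bar>u x\<bar>)\<^sup>2"
proof -
  let ?V = "unit_ball_vol (real DIM('a))" and ?a = "((2::real) ^ n) ^ DIM('a)"
  let ?I = "LINT x|lborel. \<bar>u x\<bar>"
  have [measurable]: "u \<in> borel_measurable borel" using u by (rule HH_measurable)
  have L1: "integrable lborel (\<lambda>x. \<bar>u x\<bar>)" using HH_integrable[OF u] by simp
  have "ennreal (mass u) * ennreal (real n * (?V / 2)) \<le>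
     ennreal (mass u) * (\<integral>\<^sup>+ z. ennreal (trunc_kern n (z::'a)) \<partial>lborel)"
    by (intro mult_left_mono nn_integral_trunc_kern_ge) auto
  also have "\<dots> = (\<integral>\<^sup>+ (x, y). ennreal (u x * u x) * ennreal (trunc_kern n (x - y)) \<partial>(lborel \<Otimes>\<^sub>M lborel))"
    by (subst nn_integral_tensor_kernel) (auto simp: trunc_kern_minus mass_nn_integral[OF u])
  also have "\<dots> \<le> (\<integral>\<^sup>+ p. (case p of (x, y) \<Rightarrow> ennreal ((u x - u y) * (u x - u y) * kern_k (x - y))) +
      (case p of (x, y) \<Rightarrow> ennreal (2 * ?a * (\<bar>u x\<bar> * \<bar>u y\<bar>))) \<partial>(lborel \<Otimes>\<^sub>M lborel))"
  proof (intro nn_integral_mono, clarify)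
    fix x y :: 'a
    let ?t = "trunc_kern n (x - y)"
    have "u x * u x \<le> (u x - u y) * (u x - u y) + 2 * (u x * u y)"
      by (simp add: algebra_simps)
    also have "\<dots> \<le> (u x - u y) * (u x - u y) + 2 * (\<bar>u x\<bar> * \<bar>u y\<bar>)"
      by (simp add: abs_mult[symmetric])
    finally have "u x * u x * ?t \<le> ((u x - u y) * (u x - u y) + 2 * (\<bar>u x\<bar> * \<bar>u y\<bar>)) * ?t"
      by (intro mult_right_mono) auto
    also have "\<dots> = (u x - u y) * (u x - u y) * ?t + 2 * (\<bar>u x\<bar> * \<bar>u y\<bar>) * ?t"
      by (simp add: algebra_simps)
    also have "\<dots> \<le> (u x - u y) * (u x - u y) * kern_k (x - y) + 2 * (\<bar>u x\<bar> * \<bar>u y\<bar>) * ?a"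
      by (intro add_mono mult_left_mono trunc_kern_le trunc_kern_bound) auto
    finally have "u x * u x * ?t \<le> (u x - u y) * (u x - u y) * kern_k (x - y) + 2 * ?a * (\<bar>u x\<bar> * \<bar>u y\<bar>)"
      by (simp add: mult_ac)
    then show "ennreal (u x * u x) * ennreal ?t \<le> ennreal ((u x - u y) * (u x - u y) * kern_k (x - y)) +
      ennreal (2 * ?a * (\<bar>u x\<bar> * \<bar>u y\<bar>))"
      by (simp add: ennreal_plus[symmetric] ennreal_mult[symmetric] ennreal_leI del: ennreal_plus)
  qed
  also have "\<dots> = (\<integral>\<^sup>+ (x, y). ennreal ((u x - u y) * (u x - u y) * kern_k (x - y)) \<partial>(lborel \<Otimes>\<^sub>M lborel)) +
      (\<integral>\<^sup>+ (x, y). ennreal (2 * ?a * (\<bar>u x\<bar> * \<bar>u y\<bar>)) \<partial>(lborel \<Otimes>\<^sub>M lborel))"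
    by (intro nn_integral_add) auto
  also have "(\<integral>\<^sup>+ (x, y). ennreal (2 * ?a * (\<bar>u x\<bar> * \<bar>u y\<bar>)) \<partial>(lborel \<Otimes>\<^sub>M lborel)) =
      (\<integral>\<^sup>+ p. ennreal (2 * ?a * (case p of (x, y) \<Rightarrow> \<bar>u x\<bar> * \<bar>u y\<bar>)) \<partial>(lborel \<Otimes>\<^sub>M lborel))"
    by (intro nn_integral_cong) (auto split: prod.splits)
  also have "\<dots> = ennreal (LINT p|(lborel \<Otimes>\<^sub>M lborel). 2 * ?a * (case p of (x, y) \<Rightarrow> \<bar>u x\<bar> * \<bar>u y\<bar>))"
    using integrable_tensor(1)[OF L1 L1]
    by (intro nn_integral_eq_integral) (auto split: prod.splits)
  also have "\<dots> = ennreal (2 * ?a * ?I\<^sup>2)"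
    using integrable_tensor[OF L1 L1] by (simp add: power2_eq_square)
  also note energy_nn_integral[OF u]
  finally have "ennreal (mass u * (real n * (?V / 2))) \<le>
      ennreal (2 / c_const TYPE('a) * form_E u u + 2 * ?a * ?I\<^sup>2)"
    using mass_nonneg[of u] form_E_nonneg[of u] c_const_pos[where 'a='a]
    by (simp add: ennreal_mult[symmetric] ennreal_plus[symmetric] del: ennreal_plus)
  then show ?thesis
    using mass_nonneg[of u] form_E_nonneg[of u] c_const_pos[where 'a='a]
    by (subst (asm) ennreal_le_iff) (auto simp: mult_ac)
qed

text \<open>
Choosing \<open>n\<close> in \<open>mass_le_energy_L1\<close> so large that the energy term is absorbed on the left leaves a
bound of the mass by the square of the \<open>L\<^sup>1\<close> norm.
\<close>

lemma L1_lower_bound: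
  "\<exists>\<kappa>>0. \<forall>u\<in>HH \<Omega>. form_EL u u \<le> M * mass u \<longrightarrow> \<kappa> * sqrt (mass u) \<le> (LINT x|lborel. \<bar>u x\<bar>)"
proof -
  let ?V = "unit_ball_vol (real DIM('a))" and ?c = "c_const TYPE('a)"
  define B where "B = 2 / ?c * (\<bar>M\<bar> + EL_defect) + 1"
  have V: "?V / 2 > 0" by simp
  obtain n where n: "B < real n * (?V / 2)"
    using reals_Archimedean3[OF V] by blast
  define a :: real where "a = 2 * (2 ^ n) ^ DIM('a)"
  have a: "a > 0" by (simp add: a_def)
  have "(1 / sqrt a) * sqrt (mass u) \<le> (LINT x|lborel. \<bar>u x\<bar>)"
    if u: "u \<in> HH \<Omega>" and le: "form_EL u u \<le> M * mass u" for u
  proof -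
    have "form_E u u \<le> (\<bar>M\<bar> + EL_defect) * mass u"
      using form_EL_form_E[OF u] le mult_right_mono[OF abs_ge_self mass_nonneg[of u], of M]
      by (simp add: algebra_simps)
    then have "2 / ?c * form_E u u \<le> 2 / ?c * ((\<bar>M\<bar> + EL_defect) * mass u)"
      using c_const_pos[where 'a='a] by (intro mult_left_mono) auto
    also have "\<dots> = (B - 1) * mass u" by (simp add: B_def)
    finally have "2 / ?c * form_E u u \<le> (B - 1) * mass u" .
    moreover have "B * mass u \<le> real n * (?V / 2) * mass u"
      using n mass_nonneg[of u] by (intro mult_right_mono) auto
    moreover have "(B - 1) * mass u = B * mass u - mass u" by (simp add: left_diff_distrib)
    ultimately have "mass u \<le> a * (LINT x|lborel. \<bar>u x\<bar>)\<^sup>2"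
      using mass_le_energy_L1[OF u, of n, folded a_def] by linarith
    then have "sqrt (mass u) \<le> sqrt (a * (LINT x|lborel. \<bar>u x\<bar>)\<^sup>2)" by simp
    then show ?thesis using a by (simp add: real_sqrt_mult field_simps)
  qed
  then show ?thesis using a by (intro exI[of _ "1 / sqrt a"]) auto
qed

text \<open>
For \<open>1/2 \<le> \<bar>z\<bar> < 1\<close> the point \<open>x + n z\<close> has left the bounded set \<open>\<Omega>\<close> if \<open>n\<close> is large. Then \<open>u(x)\<close>
is the sum of the \<open>n\<close> increments of \<open>u\<close> along \<open>x, x + z, \<dots>, x + n z\<close>, and by translation invariance
each increment has the same \<open>L\<^sup>2\<close> norm. Integrating over such \<open>z\<close> bounds the mass by the energy.
\<close>

lemma poincare: "\<exists>C>0. \<forall>u\<in>HH \<Omega>. mass u \<le> C * form_E u u"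
proof -
  obtain R where R: "\<And>x. x \<in> \<Omega> \<Longrightarrow> norm x < R"
    using bounded_dom by (meson bounded_pos_less)
  obtain n :: nat where n: "4 * R < real n" "n > 0"
    using reals_Archimedean2[of "max (4 * R) 0"] by auto
  define m where "m = measure lborel (shell 0 :: 'a set)"
  have mval: "m = unit_ball_vol (real DIM('a)) * (1 - (1/2) ^ DIM('a))"
    unfolding m_def measure_def emeasure_shell by (simp add: power_le_one)
  have m0: "m > 0"
    unfolding mval by (intro mult_pos_pos) (auto simp: power_less_one_iff)
  have me: "emeasure lborel (shell 0 :: 'a set) = ennreal m"
    unfolding emeasure_shell mval by simp
  have bound: "m * mass u \<le> (real n)\<^sup>2 * (2 / c_const TYPE('a) * form_E u u)" if u: "u \<in> HH \<Omega>" for u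
  proof -
    have [measurable]: "u \<in> borel_measurable borel" using u by (rule HH_measurable)
    let ?d = "\<lambda>x z. (u x - u (x + z)) * (u x - u (x + z))"
    have chain: "u x * u x \<le> (\<Sum>i<n. real n * ?d (x + real i *\<^sub>R z) z)" if z: "z \<in> shell 0" for x z
    proof (cases "x \<in> \<Omega>")
      case True
      have "norm (real n *\<^sub>R z) \<ge> real n * (1/2)"
        using z n by (auto simp: shell_def)
      moreover have "norm (real n *\<^sub>R z) \<le> norm (x + real n *\<^sub>R z) + norm x"
        using norm_triangle_ineq4[of "x + real n *\<^sub>R z" x] by simp
      ultimately have "\<not> norm (x + real n *\<^sub>R z) < R"
        using R[OF True] n by linarith
      then have "u (x + real n *\<^sub>R z) = 0" using R HH_outside[OF u] by blast
      then have "u x = (\<Sum>i<n. u (x + real i *\<^sub>R z) - u (x + real (Suc i) *\<^sub>R z))"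
        using sum_lessThan_telescope'[of "\<lambda>i. u (x + real i *\<^sub>R z)" n] by simp
      then have "(u x)\<^sup>2 \<le> real n * (\<Sum>i<n. (u (x + real i *\<^sub>R z) - u (x + real (Suc i) *\<^sub>R z))\<^sup>2)"
        using sum_squared_le_sum_of_squares[of "\<lambda>i. u (x + real i *\<^sub>R z) - u (x + real (Suc i) *\<^sub>R z)" "{..<n}"]
        by (simp add: mult.commute)
      then show ?thesis
        by (simp add: power2_eq_square sum_distrib_left algebra_simps)
    next
      case False
      then show ?thesis using HH_outside[OF u] by (auto intro!: sum_nonneg)
    qed
    have shell_z: "ennreal (mass u) \<le> ennreal ((real n)\<^sup>2) * (\<integral>\<^sup>+ x. ennreal (?d x z) \<partial>lborel)" if z: "z \<in> shell 0" for z
    proof -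
      have "ennreal (mass u) \<le> (\<integral>\<^sup>+ x. (\<Sum>i<n. ennreal (real n * ?d (x + real i *\<^sub>R z) z)) \<partial>lborel)"
        unfolding mass_nn_integral[OF u, symmetric]
        by (intro nn_integral_mono) (subst sum_ennreal, auto intro!: ennreal_leI chain[OF z])
      also have "\<dots> = (\<Sum>i<n. \<integral>\<^sup>+ x. ennreal (real n * ?d (x + real i *\<^sub>R z) z) \<partial>lborel)"
        by (intro nn_integral_sum) auto
      also have "\<dots> = (\<Sum>i<n. \<integral>\<^sup>+ x. ennreal (real n * ?d x z) \<partial>lborel)"
        by (intro sum.cong refl nn_integral_translate_right) measurable
      also have "\<dots> = ennreal ((real n)\<^sup>2) * (\<integral>\<^sup>+ x. ennreal (?d x z) \<partial>lborel)"
        by (simp add: ennreal_mult nn_integral_cmult power2_eq_square ennreal_of_nat_eq_real_of_nat mult.assoc)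
      finally show ?thesis .
    qed
    have "ennreal (mass u) * ennreal m = (\<integral>\<^sup>+ z. ennreal (mass u) * indicator (shell 0) (z::'a) \<partial>lborel)"
      by (simp add: nn_integral_cmult me)
    also have "\<dots> \<le> (\<integral>\<^sup>+ z. ennreal ((real n)\<^sup>2) * (\<integral>\<^sup>+ x. ennreal (?d x z * kern_k z) \<partial>lborel) \<partial>lborel)"
    proof (intro nn_integral_mono)
      fix z :: 'a
      show "ennreal (mass u) * indicator (shell 0) z \<le> ennreal ((real n)\<^sup>2) * (\<integral>\<^sup>+ x. ennreal (?d x z * kern_k z) \<partial>lborel)"
      proof (cases "z \<in> shell 0")
        case True
        then have "?d x z \<le> ?d x z * kern_k z" for x
          using kern_k_shell_ge[OF True] mult_left_mono[of 1 "kern_k z" "?d x z"] by simp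
        then have "(\<integral>\<^sup>+ x. ennreal (?d x z) \<partial>lborel) \<le> (\<integral>\<^sup>+ x. ennreal (?d x z * kern_k z) \<partial>lborel)"
          by (intro nn_integral_mono ennreal_leI)
        then have "ennreal ((real n)\<^sup>2) * (\<integral>\<^sup>+ x. ennreal (?d x z) \<partial>lborel) \<le>
            ennreal ((real n)\<^sup>2) * (\<integral>\<^sup>+ x. ennreal (?d x z * kern_k z) \<partial>lborel)"
          by (intro mult_left_mono) auto
        with shell_z[OF True] True show ?thesis by (auto intro: order_trans)
      qed simp
    qed
    also have "\<dots> = ennreal ((real n)\<^sup>2) * (\<integral>\<^sup>+ z. (\<integral>\<^sup>+ x. ennreal (?d x z * kern_k z) \<partial>lborel) \<partial>lborel)"
      by (intro nn_integral_cmult) measurable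
    also have "(\<integral>\<^sup>+ z. (\<integral>\<^sup>+ x. ennreal (?d x z * kern_k z) \<partial>lborel) \<partial>lborel) =
        (\<integral>\<^sup>+ x. (\<integral>\<^sup>+ z. ennreal (?d x z * kern_k z) \<partial>lborel) \<partial>lborel)"
      by (rule lborel_pair.Fubini') measurable
    also have "\<dots> = (\<integral>\<^sup>+ x. (\<integral>\<^sup>+ y. ennreal ((u x - u y) * (u x - u y) * kern_k (x - y)) \<partial>lborel) \<partial>lborel)"
    proof (rule nn_integral_cong)
      fix x
      show "(\<integral>\<^sup>+ z. ennreal (?d x z * kern_k z) \<partial>lborel) =
        (\<integral>\<^sup>+ y. ennreal ((u x - u y) * (u x - u y) * kern_k (x - y)) \<partial>lborel)"
        using nn_integral_translate[of "\<lambda>y. ennreal ((u x - u y) * (u x - u y) * kern_k (x - y))" x]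
        by (simp add: kern_k_minus)
    qed
    also have "\<dots> = (\<integral>\<^sup>+ (x, y). ennreal ((u x - u y) * (u x - u y) * kern_k (x - y)) \<partial>(lborel \<Otimes>\<^sub>M lborel))"
      by (subst lborel.nn_integral_fst[symmetric]) auto
    also note energy_nn_integral[OF u]
    finally have "ennreal (m * mass u) \<le> ennreal ((real n)\<^sup>2 * (2 / c_const TYPE('a) * form_E u u))"
      using mass_nonneg[of u] form_E_nonneg[of u] m0 c_const_pos[where 'a='a]
      by (simp add: ennreal_mult[symmetric] mult.commute)
    then show ?thesis
      using mass_nonneg[of u] form_E_nonneg[of u] m0 c_const_pos[where 'a='a]
      by (subst (asm) ennreal_le_iff) auto
  qed
  let ?C = "(real n)\<^sup>2 * (2 / c_const TYPE('a)) / m"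
  have "?C > 0" using n m0 c_const_pos[where 'a='a] by simp
  moreover have "mass u \<le> ?C * form_E u u" if "u \<in> HH \<Omega>" for u
    using divide_right_mono[OF bound[OF that], of m] m0 by simp
  ultimately show ?thesis by blast
qed

text \<open>
Since \<open>p = u\<^sup>+\<close> and \<open>q = u\<^sup>-\<close> have disjoint supports, the mixed integrand of \<open>form_E\<close> is
\<open>- (p(x) q(y) + q(x) p(y)) k(x - y)\<close>. It has the same sign as the mixed term with \<open>j\<close>, and together
they carry the kernel \<open>k + j = \<bar>z\<bar>\<^sup>-\<^sup>N\<close>, which is bounded below on differences of points of \<open>\<Omega>\<close>.
\<close>

lemma form_EL_split:
  "\<exists>\<beta>>0. \<forall>u\<in>HH \<Omega>. form_EL (ppart u) (ppart u) + form_EL (ppart (\<lambda>x. - u x)) (ppart (\<lambda>x. - u x)) +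
     \<beta> * (LINT x|lborel. ppart u x) * (LINT x|lborel. ppart (\<lambda>x. - u x) x) \<le> form_EL u u"
proof -
  obtain S where S: "S > 0" "\<And>x. x \<in> \<Omega> \<Longrightarrow> norm x < S"
    using bounded_dom by (meson bounded_pos_less)
  let ?c = "c_const TYPE('a)"
  define b where "b = 1 / (2 * S) ^ DIM('a)"
  have b: "b > 0" using S by (simp add: b_def)
  have kern: "b \<le> kern_k (x - y) + kern_j (x - y)" if "x \<in> \<Omega>" "y \<in> \<Omega>" "x \<noteq> y" for x y
  proof -
    have "norm (x - y) \<le> 2 * S" "norm (x - y) > 0"
      using S(2)[OF that(1)] S(2)[OF that(2)] norm_triangle_ineq4[of x y] that by auto
    then have "b \<le> 1 / norm (x - y) ^ DIM('a)"
      unfolding b_def using S(1) by (intro divide_left_mono power_mono mult_pos_pos zero_less_power) auto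
    also have "\<dots> = kern_k (x - y) + kern_j (x - y)"
      by (auto simp: kern_k_def kern_j_def indicator_def)
    finally show ?thesis .
  qed
  have "form_EL (ppart u) (ppart u) + form_EL (ppart (\<lambda>x. - u x)) (ppart (\<lambda>x. - u x)) +
     (2 * ?c * b) * (LINT x|lborel. ppart u x) * (LINT x|lborel. ppart (\<lambda>x. - u x) x) \<le> form_EL u u"
    if u: "u \<in> HH \<Omega>" for u
  proof -
    define p q where "p = ppart u" and "q = ppart (\<lambda>x. - u x)"
    have p: "p \<in> HH \<Omega>" and q: "q \<in> HH \<Omega>"
      using HH_ppart[OF u] HH_ppart[OF HH_uminus[OF u]] by (simp_all add: p_def q_def)
    have pq0: "p x * q x = 0" "0 \<le> p x" "0 \<le> q x" for x by (auto simp: p_def q_def max_def)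
    have "form_EL u u = form_EL (\<lambda>x. 1 * p x + (-1) * q x) (\<lambda>x. 1 * p x + (-1) * q x)"
      by (intro arg_cong2[of _ _ _ _ form_EL]) (auto simp: p_def q_def max_def)
    also have "\<dots> = form_EL p p - (form_EL p q + form_EL q p) + form_EL q q"
      by (simp only: form_EL_expand[OF p q]) simp
    finally have EL: "form_EL u u = form_EL p p - (form_EL p q + form_EL q p) + form_EL q q" .
    let ?E = "\<lambda>u v. \<lambda>(x, y). (u x - u y) * (v x - v y) * kern_k (x - y)"
    let ?J = "\<lambda>u v. \<lambda>(x, y). u x * v y * kern_j (x - y)"
    let ?T = "\<lambda>u v. \<lambda>(x, y). u x * v y"
    let ?M = "lborel \<Otimes>\<^sub>M lborel :: ('a \<times> 'a) measure"
    have "(\<lambda>x. p x * q x) = (\<lambda>_. 0)" using pq0(1) by auto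
    then have ip0: "ip p q = 0" "ip q p = 0"
      by (simp_all add: ip_def mult.commute)
    have "form_EL p q + form_EL q p = ?c * (LINT z|?M. (?E p q z + ?E q p z) / 2 - (?J p q z + ?J q p z))"
      using form_E_integrable[OF p q] form_E_integrable[OF q p] form_J_integrable[OF p q] form_J_integrable[OF q p]
      by (simp add: form_EL_eq ip0 form_E_def form_J_def algebra_simps add_divide_distrib)
    also have "\<dots> \<le> ?c * (LINT z|?M. - (b * (?T p q z + ?T q p z)))"
    proof (intro mult_left_mono integral_mono)
      show "integrable ?M (\<lambda>z. (?E p q z + ?E q p z) / 2 - (?J p q z + ?J q p z))"
        using form_E_integrable[OF p q] form_E_integrable[OF q p] form_J_integrable[OF p q] form_J_integrable[OF q p]
        by (intro Bochner_Integration.integrable_diff Bochner_Integration.integrable_divide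
            Bochner_Integration.integrable_add)
      show "integrable ?M (\<lambda>z. - (b * (?T p q z + ?T q p z)))"
        using integrable_tensor(1)[OF HH_integrable[OF p] HH_integrable[OF q]]
          integrable_tensor(1)[OF HH_integrable[OF q] HH_integrable[OF p]]
        by (intro integrable_minus integrable_mult_right Bochner_Integration.integrable_add)
      fix z :: "'a \<times> 'a"
      obtain x y where z: "z = (x, y)" by (cases z)
      have "(?E p q z + ?E q p z) / 2 - (?J p q z + ?J q p z) =
          - ((p x * q y + q x * p y) * (kern_k (x - y) + kern_j (x - y)))"
        using pq0(1)[of x] pq0(1)[of y] by (auto simp: z field_simps)
      moreover have "b * (p x * q y + q x * p y) \<le> (p x * q y + q x * p y) * (kern_k (x - y) + kern_j (x - y))"
      proof (cases "x \<in> \<Omega> \<and> y \<in> \<Omega> \<and> x \<noteq> y")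
        case True
        then show ?thesis
          using kern[of x y] pq0(2,3) by (subst mult.commute) (intro mult_left_mono, auto)
      next
        case False
        then have "p x * q y + q x * p y = 0"
          using HH_outside[OF p] HH_outside[OF q] pq0(1)[of x] by (auto simp: mult.commute)
        then show ?thesis by simp
      qed
      ultimately show "(?E p q z + ?E q p z) / 2 - (?J p q z + ?J q p z) \<le> - (b * (?T p q z + ?T q p z))"
        by (simp add: z)
    qed (use c_const_pos[where 'a='a] in auto)
    also have "\<dots> = - (2 * ?c * b * (LINT x|lborel. p x) * (LINT x|lborel. q x))"
      using integrable_tensor[OF HH_integrable[OF p] HH_integrable[OF q]]
        integrable_tensor[OF HH_integrable[OF q] HH_integrable[OF p]]
      by (simp add: algebra_simps)
    finally show ?thesis using EL by (simp add: p_def q_def)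
  qed
  then show ?thesis
    using b c_const_pos[where 'a='a] by (intro exI[of _ "2 * ?c * b"]) auto
qed

end

section \<open>Continuity along paths\<close>

text \<open>
Every continuity estimate below comes from a Young inequality with a free parameter \<open>\<tau>\<close>: one
first makes \<open>A \<tau>\<close> small and then lets \<open>g\<close> tend to zero.
\<close>

lemma tendsto_by_young:
  fixes f g :: "'b \<Rightarrow> real"
  assumes g: "(g \<longlongrightarrow> 0) F" and A: "0 \<le> A"
    and le: "\<And>\<tau>. 0 < \<tau> \<Longrightarrow> \<tau> \<le> 1 \<Longrightarrow> \<forall>\<^sub>F s in F. \<bar>f s - L\<bar> \<le> A * \<tau> + B * g s / \<tau>"
  shows "(f \<longlongrightarrow> L) F"
proof (rule tendstoI)
  fix e :: real assume e: "e > 0"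
  define \<tau> where "\<tau> = min 1 (e / (2 * (A + 1)))"
  have \<tau>: "0 < \<tau>" "\<tau> \<le> 1" using e A by (auto simp: \<tau>_def)
  have "A * \<tau> \<le> A * (e / (2 * (A + 1)))"
    using A by (intro mult_left_mono) (auto simp: \<tau>_def)
  also have "\<dots> < e" using A e by (simp add: field_simps) (smt (verit) mult_nonneg_nonneg)
  finally have Ae: "A * \<tau> < e" .
  have "((\<lambda>s. A * \<tau> + B * g s / \<tau>) \<longlongrightarrow> A * \<tau> + B * 0 / \<tau>) F"
    using \<tau> by (intro tendsto_intros g) auto
  then have "\<forall>\<^sub>F s in F. A * \<tau> + B * g s / \<tau> < e"
    using Ae by (intro order_tendstoD) auto
  then show "\<forall>\<^sub>F s in F. dist (f s) L < e"
    using le[OF \<tau>] by eventually_elim (simp add: dist_real_def)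
qed

context bounded_open
begin

definition energy :: "('a \<Rightarrow> real) \<Rightarrow> real" where
  "energy u = form_E u u"

text \<open>
Continuity with respect to \<open>norm_H\<close>, stated for its square because the energy, unlike the norm,
can be expanded as a quadratic form.
\<close>

definition energy_path :: "real set \<Rightarrow> (real \<Rightarrow> 'a \<Rightarrow> real) \<Rightarrow> bool" where
  "energy_path S \<gamma> \<longleftrightarrow> (\<forall>t\<in>S. \<gamma> t \<in> HH \<Omega>) \<and>
     (\<forall>t\<in>S. ((\<lambda>s. energy (\<lambda>x. \<gamma> s x - \<gamma> t x)) \<longlongrightarrow> 0) (at t within S))"

text \<open>
The Poincare inequality makes the energy dominate \<open>mass\<close> and \<open>form_EL\<close>, so convergence in energy
suffices for the continuity of all functionals involved.
\<close>

lemma energy_controls: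
  "\<exists>C>0. \<forall>u\<in>HH \<Omega>. mass u \<le> C * energy u \<and> \<bar>form_EL u u\<bar> \<le> C * energy u"
proof -
  obtain C where C: "C > 0" "\<And>u. u \<in> HH \<Omega> \<Longrightarrow> mass u \<le> C * form_E u u"
    using poincare by blast
  have "mass u \<le> (C + EL_defect * C + 1) * form_E u u \<and> \<bar>form_EL u u\<bar> \<le> (C + EL_defect * C + 1) * form_E u u"
    if u: "u \<in> HH \<Omega>" for u
  proof -
    have "EL_defect * mass u \<le> EL_defect * (C * form_E u u)"
      using C(2)[OF u] EL_defect_nonneg by (intro mult_left_mono)
    moreover have "0 \<le> EL_defect * C * form_E u u" "0 \<le> C * form_E u u"
      using form_E_nonneg[of u] C(1) EL_defect_nonneg by auto
    ultimately show ?thesis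
      using C(2)[OF u] form_EL_form_E[OF u] form_E_nonneg[of u]
      by (auto simp: distrib_right mult.assoc abs_le_iff)
  qed
  moreover have "C + EL_defect * C + 1 > 0" using C(1) EL_defect_nonneg by (simp add: add_pos_nonneg)
  ultimately show ?thesis unfolding energy_def by blast
qed

lemma ppart_mass_diff:
  assumes u: "u \<in> HH \<Omega>" and v: "v \<in> HH \<Omega>" and \<tau>: "0 < \<tau>" "\<tau> \<le> 1"
  shows "\<bar>mass (ppart u) - mass (ppart v)\<bar> \<le> \<tau> * mass v + 2 * mass (\<lambda>x. u x - v x) / \<tau>"
proof -
  have pw: "\<bar>max a 0 * max a 0 - max b 0 * max b 0\<bar> \<le> \<tau> * (b * b) + (2 / \<tau>) * ((a - b) * (a - b))" for a b :: real
  proof -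
    let ?w = "\<bar>a - b\<bar>"
    have "\<bar>max a 0 * max a 0 - max b 0 * max b 0\<bar> = \<bar>max a 0 - max b 0\<bar> * \<bar>max a 0 + max b 0\<bar>"
      by (simp add: square_diff_square_factored abs_mult mult.commute)
    also have "\<dots> \<le> ?w * (?w + 2 * \<bar>b\<bar>)"
      by (intro mult_mono) auto
    also have "\<dots> = ?w * ?w + 2 * (?w * \<bar>b\<bar>)" by (simp add: algebra_simps)
    finally have "\<bar>max a 0 * max a 0 - max b 0 * max b 0\<bar> \<le> ?w * ?w + 2 * (?w * \<bar>b\<bar>)" .
    moreover have "2 * (?w * \<bar>b\<bar>) \<le> \<tau> * (b * b) + ?w * ?w / \<tau>"
    proof -
      have "0 \<le> (\<tau> * \<bar>b\<bar> - ?w)\<^sup>2" by simp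
      then show ?thesis using \<tau> by (simp add: power2_eq_square field_simps)
    qed
    moreover have "?w * ?w \<le> ?w * ?w / \<tau>"
      using \<tau> mult_right_mono[of \<tau> 1 "?w * ?w"] by (simp add: pos_le_divide_eq mult.commute[of _ \<tau>])
    moreover have "(2 / \<tau>) * ((a - b) * (a - b)) = 2 * (?w * ?w / \<tau>)" by simp
    ultimately show ?thesis by linarith
  qed
  have int: "integrable lborel (\<lambda>x. ppart u x * ppart u x)" "integrable lborel (\<lambda>x. ppart v x * ppart v x)"
    "integrable lborel (\<lambda>x. v x * v x)" "integrable lborel (\<lambda>x. (u x - v x) * (u x - v x))"
    using HH_square[OF HH_ppart[OF u]] HH_square[OF HH_ppart[OF v]] HH_square[OF v] HH_square[OF HH_diff[OF u v]]
    by auto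
  have "\<bar>mass (ppart u) - mass (ppart v)\<bar> = \<bar>LINT x|lborel. ppart u x * ppart u x - ppart v x * ppart v x\<bar>"
    unfolding ip_def using int by simp
  also have "\<dots> \<le> (LINT x|lborel. \<tau> * (v x * v x) + (2 / \<tau>) * ((u x - v x) * (u x - v x)))"
    using int pw
    by (intro integral_abs_bound_integral Bochner_Integration.integrable_diff
        Bochner_Integration.integrable_add integrable_mult_right) auto
  also have "\<dots> = \<tau> * mass v + (2 / \<tau>) * mass (\<lambda>x. u x - v x)"
    unfolding ip_def using int by simp
  finally show ?thesis by simp
qed

text \<open>
The mixed term of \<open>v\<close> and \<open>w = u - v\<close> is recovered from the value of the form at
\<open>\<surd>\<tau> v + w / \<surd>\<tau>\<close>; this is Young's inequality for a form that need not be positive.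
\<close>

lemma form_EL_diff:
  assumes C: "\<And>u. u \<in> HH \<Omega> \<Longrightarrow> \<bar>form_EL u u\<bar> \<le> C * energy u" "C > 0"
    and u: "u \<in> HH \<Omega>" and v: "v \<in> HH \<Omega>" and \<tau>: "0 < \<tau>" "\<tau> \<le> 1"
  shows "\<bar>form_EL u u - form_EL v v\<bar> \<le> 3 * C * energy v * \<tau> + 4 * C * energy (\<lambda>x. u x - v x) / \<tau>"
proof -
  define w where "w = (\<lambda>x. u x - v x)"
  have w: "w \<in> HH \<Omega>" unfolding w_def using u v by (rule HH_diff)
  define X where "X = form_EL v w + form_EL w v"
  let ?s = "sqrt \<tau>"
  let ?z = "\<lambda>x. ?s * v x + (1 / ?s) * w x"
  have s: "?s > 0" "?s\<^sup>2 = \<tau>" using \<tau> by auto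
  have uw: "u = (\<lambda>x. 1 * v x + 1 * w x)" by (simp add: w_def)
  have "form_EL u u = form_EL v v + X + form_EL w w"
    by (subst uw, subst uw) (simp only: form_EL_expand[OF v w] X_def, simp)
  then have "\<bar>form_EL u u - form_EL v v\<bar> \<le> \<bar>X\<bar> + C * energy w"
    using C(1)[OF w] by linarith
  moreover have "form_EL ?z ?z = \<tau> * form_EL v v + X + form_EL w w / \<tau>"
    using s by (simp only: form_EL_expand[OF v w] X_def) (simp add: power_divide)
  then have "\<bar>X\<bar> \<le> \<bar>form_EL ?z ?z\<bar> + \<bar>\<tau> * form_EL v v\<bar> + \<bar>form_EL w w / \<tau>\<bar>" by linarith
  moreover have "\<bar>form_EL ?z ?z\<bar> \<le> C * energy ?z" by (rule C(1)[OF HH_combination[OF v w]])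
  moreover have "C * energy ?z \<le> C * (2 * \<tau> * energy v + 2 * energy w / \<tau>)"
    using form_E_add_le[OF v w, of ?s "1 / ?s"] s C(2) unfolding energy_def
    by (intro mult_left_mono) (auto simp: power_divide)
  moreover have "\<bar>\<tau> * form_EL v v\<bar> \<le> \<tau> * (C * energy v)"
    using C(1)[OF v] \<tau> by (simp add: abs_mult)
  moreover have "\<bar>form_EL w w / \<tau>\<bar> \<le> C * energy w / \<tau>"
    using C(1)[OF w] \<tau> by (simp add: divide_right_mono)
  moreover have "C * energy w \<le> C * energy w / \<tau>"
    using \<tau> C(2) form_E_nonneg[of w] mult_right_mono[of \<tau> 1 "C * energy w"]
    by (simp add: pos_le_divide_eq energy_def mult.commute)
  moreover have "C * (2 * \<tau> * energy v + 2 * energy w / \<tau>) = 2 * (\<tau> * (C * energy v)) + 2 * (C * energy w / \<tau>)"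
    by (simp add: field_simps)
  ultimately have "\<bar>form_EL u u - form_EL v v\<bar> \<le> 3 * (\<tau> * (C * energy v)) + 4 * (C * energy w / \<tau>)"
    by linarith
  then show ?thesis by (simp add: w_def mult_ac)
qed

lemma energy_path_continuous:
  assumes "energy_path S \<gamma>"
  shows "continuous_on S (\<lambda>t. form_EL (\<gamma> t) (\<gamma> t))"
    and "continuous_on S (\<lambda>t. mass (ppart (\<gamma> t)))"
    and "\<And>v. v \<in> HH \<Omega> \<Longrightarrow> continuous_on S (\<lambda>t. ip (\<gamma> t) v)"
proof -
  obtain C where C: "C > 0" "\<And>u. u \<in> HH \<Omega> \<Longrightarrow> mass u \<le> C * energy u"
    "\<And>u. u \<in> HH \<Omega> \<Longrightarrow> \<bar>form_EL u u\<bar> \<le> C * energy u"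
    using energy_controls by blast
  have HH: "\<gamma> t \<in> HH \<Omega>" if "t \<in> S" for t using assms that by (auto simp: energy_path_def)
  have lim: "((\<lambda>s. energy (\<lambda>x. \<gamma> s x - \<gamma> t x)) \<longlongrightarrow> 0) (at t within S)" if "t \<in> S" for t
    using assms that by (auto simp: energy_path_def)
  have ev: "\<forall>\<^sub>F s in at t within S. s \<in> S" for t by (simp add: eventually_at_filter)
  show "continuous_on S (\<lambda>t. form_EL (\<gamma> t) (\<gamma> t))"
    unfolding continuous_on_def
  proof
    fix t assume t: "t \<in> S"
    show "((\<lambda>t. form_EL (\<gamma> t) (\<gamma> t)) \<longlongrightarrow> form_EL (\<gamma> t) (\<gamma> t)) (at t within S)"
    proof (rule tendsto_by_young[OF lim[OF t], of "3 * C * energy (\<gamma> t)" _ _ "4 * C"])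
      fix \<tau> :: real assume "0 < \<tau>" "\<tau> \<le> 1"
      then show "\<forall>\<^sub>F s in at t within S. \<bar>form_EL (\<gamma> s) (\<gamma> s) - form_EL (\<gamma> t) (\<gamma> t)\<bar> \<le>
          3 * C * energy (\<gamma> t) * \<tau> + 4 * C * energy (\<lambda>x. \<gamma> s x - \<gamma> t x) / \<tau>"
        by (intro eventually_mono[OF ev] form_EL_diff C HH t)
    qed (use C(1) form_E_nonneg[of "\<gamma> t"] in \<open>simp add: energy_def\<close>)
  qed
  show "continuous_on S (\<lambda>t. mass (ppart (\<gamma> t)))"
    unfolding continuous_on_def
  proof
    fix t assume t: "t \<in> S"
    show "((\<lambda>t. mass (ppart (\<gamma> t))) \<longlongrightarrow> mass (ppart (\<gamma> t))) (at t within S)"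
    proof (rule tendsto_by_young[OF lim[OF t], of "mass (\<gamma> t)" _ _ "2 * C"])
      fix \<tau> :: real assume \<tau>: "0 < \<tau>" "\<tau> \<le> 1"
      show "\<forall>\<^sub>F s in at t within S. \<bar>mass (ppart (\<gamma> s)) - mass (ppart (\<gamma> t))\<bar> \<le>
          mass (\<gamma> t) * \<tau> + 2 * C * energy (\<lambda>x. \<gamma> s x - \<gamma> t x) / \<tau>"
      proof (rule eventually_mono[OF ev])
        fix s assume s: "s \<in> S"
        have "2 * mass (\<lambda>x. \<gamma> s x - \<gamma> t x) / \<tau> \<le> 2 * C * energy (\<lambda>x. \<gamma> s x - \<gamma> t x) / \<tau>"
          using C(2)[OF HH_diff[OF HH[OF s] HH[OF t]]] \<tau> by (intro divide_right_mono) auto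
        then show "\<bar>mass (ppart (\<gamma> s)) - mass (ppart (\<gamma> t))\<bar> \<le>
          mass (\<gamma> t) * \<tau> + 2 * C * energy (\<lambda>x. \<gamma> s x - \<gamma> t x) / \<tau>"
          using ppart_mass_diff[OF HH[OF s] HH[OF t] \<tau>] by (simp add: mult.commute)
      qed
    qed (rule mass_nonneg)
  qed
  fix v assume v: "v \<in> HH \<Omega>"
  show "continuous_on S (\<lambda>t. ip (\<gamma> t) v)"
    unfolding continuous_on_def
  proof
    fix t assume t: "t \<in> S"
    show "((\<lambda>t. ip (\<gamma> t) v) \<longlongrightarrow> ip (\<gamma> t) v) (at t within S)"
    proof (rule tendsto_by_young[OF lim[OF t], of "mass v" _ _ C])
      fix \<tau> :: real assume \<tau>: "0 < \<tau>" "\<tau> \<le> 1"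
      show "\<forall>\<^sub>F s in at t within S. \<bar>ip (\<gamma> s) v - ip (\<gamma> t) v\<bar> \<le>
          mass v * \<tau> + C * energy (\<lambda>x. \<gamma> s x - \<gamma> t x) / \<tau>"
      proof (rule eventually_mono[OF ev])
        fix s assume s: "s \<in> S"
        let ?w = "\<lambda>x. \<gamma> s x - \<gamma> t x"
        have w: "?w \<in> HH \<Omega>" using HH[OF s] HH[OF t] by (rule HH_diff)
        have "ip (\<gamma> s) v - ip (\<gamma> t) v = ip v ?w"
          using ip_combination[OF HH[OF s] HH[OF t] v, of 1 "-1"] by (simp add: ip_commute[of v])
        moreover have "mass ?w / \<tau> \<le> C * energy ?w / \<tau>"
          using C(2)[OF w] \<tau> by (intro divide_right_mono) auto
        ultimately show "\<bar>ip (\<gamma> s) v - ip (\<gamma> t) v\<bar> \<le> mass v * \<tau> + C * energy ?w / \<tau>"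
          using ip_le_young[OF v w \<tau>(1)] by (simp add: mult.commute)
      qed
    qed (rule mass_nonneg)
  qed
qed

lemma energy_path_combination:
  assumes \<gamma>: "energy_path S \<gamma>" and v: "v \<in> HH \<Omega>"
    and a: "continuous_on S a" and b: "continuous_on S b"
  shows "energy_path S (\<lambda>t x. a t * \<gamma> t x + b t * v x)"
  unfolding energy_path_def
proof (intro conjI ballI)
  have HH: "\<gamma> t \<in> HH \<Omega>" if "t \<in> S" for t using \<gamma> that by (auto simp: energy_path_def)
  fix t assume t: "t \<in> S"
  show "(\<lambda>x. a t * \<gamma> t x + b t * v x) \<in> HH \<Omega>" using HH[OF t] v by (rule HH_combination)
  have lim: "((\<lambda>s. energy (\<lambda>x. \<gamma> s x - \<gamma> t x)) \<longlongrightarrow> 0) (at t within S)"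
    using \<gamma> t by (auto simp: energy_path_def)
  have at: "(a \<longlongrightarrow> a t) (at t within S)" and bt: "(b \<longlongrightarrow> b t) (at t within S)"
    using a b t by (auto simp: continuous_on_def)
  let ?d = "\<lambda>s x. a s * \<gamma> s x + b s * v x - (a t * \<gamma> t x + b t * v x)"
  let ?B = "\<lambda>s. 2 * (a s)\<^sup>2 * energy (\<lambda>x. \<gamma> s x - \<gamma> t x) +
     2 * (2 * (a s - a t)\<^sup>2 * energy (\<gamma> t) + 2 * (b s - b t)\<^sup>2 * energy v)"
  have "(?B \<longlongrightarrow> 2 * (a t)\<^sup>2 * 0 + 2 * (2 * (a t - a t)\<^sup>2 * energy (\<gamma> t) + 2 * (b t - b t)\<^sup>2 * energy v)) (at t within S)"
    by (intro tendsto_intros at bt lim)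
  then have B0: "(?B \<longlongrightarrow> 0) (at t within S)" by simp
  have B1: "\<forall>\<^sub>F s in at t within S. energy (?d s) \<le> ?B s"
  proof -
    have "energy (?d s) \<le> ?B s" if s: "s \<in> S" for s
    proof -
      let ?w = "\<lambda>x. \<gamma> s x - \<gamma> t x" and ?r = "\<lambda>x. (a s - a t) * \<gamma> t x + (b s - b t) * v x"
      have w: "?w \<in> HH \<Omega>" using HH[OF s] HH[OF t] by (rule HH_diff)
      have r: "?r \<in> HH \<Omega>" using HH[OF t] v by (rule HH_combination)
      have "?d s = (\<lambda>x. a s * ?w x + 1 * ?r x)" by (auto simp: algebra_simps)
      then have "energy (?d s) \<le> 2 * (a s)\<^sup>2 * energy ?w + 2 * energy ?r"
        using form_E_add_le[OF w r, of "a s" 1] by (simp add: energy_def)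
      also have "energy ?r \<le> 2 * (a s - a t)\<^sup>2 * energy (\<gamma> t) + 2 * (b s - b t)\<^sup>2 * energy v"
        using form_E_add_le[OF HH[OF t] v] by (simp add: energy_def)
      finally show ?thesis by simp
    qed
    then show ?thesis by (simp add: eventually_at_filter)
  qed
  have B2: "\<forall>\<^sub>F s in at t within S. 0 \<le> energy (?d s)"
    by (simp add: energy_def form_E_nonneg)
  show "((\<lambda>s. energy (?d s)) \<longlongrightarrow> 0) (at t within S)"
    by (rule tendsto_sandwich[OF B2 B1 tendsto_const B0])
qed

lemma energy_path_const: "v \<in> HH \<Omega> \<Longrightarrow> energy_path S (\<lambda>_. v)"
  by (simp add: energy_path_def energy_def form_E_def split_def)

lemma PP_iff: "u \<in> PP \<Omega> \<longleftrightarrow> u \<in> HH \<Omega> \<and> mass u = 1"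
proof -
  have "(LINT x:\<Omega>|lborel. (u x)\<^sup>2) = mass u" if "u \<in> HH \<Omega>"
    unfolding set_lebesgue_integral_def ip_def
    using HH_outside[OF that]
    by (intro Bochner_Integration.integral_cong) (auto simp: power2_eq_square indicator_def)
  then show ?thesis by (auto simp: PP_def)
qed

lemma E_r_eq: "u \<in> HH \<Omega> \<Longrightarrow> E_r \<Omega> r u = form_EL u u - r * mass (ppart u)"
proof -
  assume u: "u \<in> HH \<Omega>"
  have "(LINT x:\<Omega>|lborel. (max (u x) 0)\<^sup>2) = mass (ppart u)"
    unfolding set_lebesgue_integral_def ip_def
    using HH_outside[OF u]
    by (intro Bochner_Integration.integral_cong) (auto simp: power2_eq_square indicator_def)
  then show ?thesis by (simp add: E_r_def)
qed

lemma paths_iff: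
  "\<gamma> \<in> paths \<Omega> \<phi> \<longleftrightarrow> energy_path {-1..1} \<gamma> \<and> (\<forall>t\<in>{-1..1}. mass (\<gamma> t) = 1) \<and>
     (AE x in lborel. \<gamma> (-1) x = - \<phi> x) \<and> (AE x in lborel. \<gamma> 1 x = \<phi> x)"
proof -
  have lim: "((\<lambda>s. norm_H (f s)) \<longlongrightarrow> 0) F \<longleftrightarrow> ((\<lambda>s. energy (f s)) \<longlongrightarrow> 0) F" for f :: "real \<Rightarrow> 'a \<Rightarrow> real" and F
  proof
    assume "((\<lambda>s. norm_H (f s)) \<longlongrightarrow> 0) F"
    from tendsto_power[OF this, of 2] show "((\<lambda>s. energy (f s)) \<longlongrightarrow> 0) F"
      by (simp add: norm_H_square energy_def)
  next
    assume "((\<lambda>s. energy (f s)) \<longlongrightarrow> 0) F"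
    from tendsto_real_sqrt[OF this] show "((\<lambda>s. norm_H (f s)) \<longlongrightarrow> 0) F"
      by (simp add: norm_H_def energy_def)
  qed
  show ?thesis unfolding paths_def energy_path_def lim by (auto simp: PP_iff)
qed

lemma energy_path_E_r_continuous:
  assumes "energy_path S \<gamma>" shows "continuous_on S (\<lambda>t. E_r \<Omega> r (\<gamma> t))"
proof -
  have "continuous_on S (\<lambda>t. form_EL (\<gamma> t) (\<gamma> t) - r * mass (ppart (\<gamma> t)))"
    using energy_path_continuous[OF assms] by (intro continuous_intros)
  then show ?thesis
    using assms by (subst continuous_on_cong[OF refl]) (auto simp: E_r_eq energy_path_def)
qed

lemma mass_ppart_le: assumes "u \<in> HH \<Omega>" shows "mass (ppart u) \<le> mass u"
  unfolding ip_def using HH_square[OF assms] HH_square[OF HH_ppart[OF assms]]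
  by (intro integral_mono) (auto simp: max_def)

lemma mass_split:
  assumes u: "u \<in> HH \<Omega>"
  shows "mass u = mass (ppart u) + mass (ppart (\<lambda>x. - u x))"
proof -
  have "mass u = (LINT x|lborel. ppart u x * ppart u x + ppart (\<lambda>x. - u x) x * ppart (\<lambda>x. - u x) x)"
    unfolding ip_def by (intro Bochner_Integration.integral_cong) (auto simp: max_def)
  also have "\<dots> = mass (ppart u) + mass (ppart (\<lambda>x. - u x))"
    unfolding ip_def using HH_square[OF HH_ppart[OF u]] HH_square[OF HH_ppart[OF HH_uminus[OF u]]]
    by (intro Bochner_Integration.integral_add)
  finally show ?thesis .
qed

section \<open>Existence of paths\<close>

text \<open>
The cone function is 1-Lipschitz and supported in a ball \<open>B\<close>, so its energy density is at most
\<open>\<bar>x - y\<bar>\<^sup>2 k(x - y)\<close>, and it vanishes unless \<open>x\<close> or \<open>y\<close> lies in \<open>B\<close>.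
\<close>

lemma bump_HH:
  assumes \<rho>: "0 < \<rho>" and sub: "ball x0 \<rho> \<subseteq> \<Omega>"
  shows "(\<lambda>x. max 0 (\<rho> - dist x x0)) \<in> HH \<Omega>" (is "?b \<in> _")
proof -
  let ?B = "ball x0 \<rho>" and ?K = "\<lambda>z::'a. ennreal ((norm z)\<^sup>2 * kern_k z)"
  let ?M = "lborel \<Otimes>\<^sub>M lborel :: ('a \<times> 'a) measure"
  have zero: "?b x = 0" if "x \<notin> ?B" for x using that by (simp add: dist_commute)
  have out: "\<forall>x. x \<notin> \<Omega> \<longrightarrow> ?b x = 0" using zero sub by blast
  have [measurable]: "?B \<in> sets borel" by simp
  have "integrable lborel (\<lambda>x. ?b x * ?b x)"
  proof (rule Bochner_Integration.integrable_bound)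
    show "integrable lborel (\<lambda>x. (\<rho> * \<rho>) * indicator ?B x :: real)"
      by (intro integrable_mult_right) (simp add: integrable_indicator_iff emeasure_ball \<rho> less_imp_le)
    have "?b x * ?b x \<le> (\<rho> * \<rho>) * indicator ?B x" for x
    proof (cases "x \<in> ?B")
      case True
      then show ?thesis using \<rho> by (auto intro!: mult_mono)
    qed (use zero in simp)
    then show "AE x in lborel. norm (?b x * ?b x) \<le> norm ((\<rho> * \<rho>) * indicator ?B x :: real)"
      using \<rho> by (intro AE_I2) (auto simp: abs_mult)
  qed measurable
  moreover have "integrable ?M (\<lambda>(x, y). (?b x - ?b y) * (?b x - ?b y) * kern_k (x - y))"
  proof (rule integrableI_bounded)
    have "(\<integral>\<^sup>+ p. ennreal (norm (case p of (x, y) \<Rightarrow> (?b x - ?b y) * (?b x - ?b y) * kern_k (x - y))) \<partial>?M) \<le>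
       (\<integral>\<^sup>+ p. (case p of (x, y) \<Rightarrow> indicator ?B x * ?K (x - y)) + (case p of (x, y) \<Rightarrow> indicator ?B y * ?K (x - y)) \<partial>?M)"
    proof (intro nn_integral_mono, clarify)
      fix x y :: 'a
      have "(?b x - ?b y) * (?b x - ?b y) * kern_k (x - y) \<le> (norm (x - y))\<^sup>2 * kern_k (x - y)"
      proof (intro mult_right_mono)
        have "\<bar>?b x - ?b y\<bar> \<le> dist x y"
          using dist_triangle[of x x0 y] dist_triangle[of y x0 x] by (auto simp: max_def dist_commute)
        then have "\<bar>?b x - ?b y\<bar>\<^sup>2 \<le> (norm (x - y))\<^sup>2" by (intro power_mono) (auto simp: dist_norm)
        then show "(?b x - ?b y) * (?b x - ?b y) \<le> (norm (x - y))\<^sup>2" by (simp add: power2_eq_square)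
      qed simp
      then have le: "ennreal (norm ((?b x - ?b y) * (?b x - ?b y) * kern_k (x - y))) \<le> ?K (x - y)"
        by (intro ennreal_leI) simp
      show "ennreal (norm ((?b x - ?b y) * (?b x - ?b y) * kern_k (x - y))) \<le>
          indicator ?B x * ?K (x - y) + indicator ?B y * ?K (x - y)"
      proof (cases "x \<in> ?B \<or> y \<in> ?B")
        case True
        have "?K (x - y) \<le> indicator ?B x * ?K (x - y) + indicator ?B y * ?K (x - y)"
          using True by (auto simp: indicator_def)
        with le show ?thesis by (rule order_trans)
      next
        case False
        then show ?thesis using zero[of x] zero[of y] by simp
      qed
    qed
    also have "\<dots> = (\<integral>\<^sup>+ (x, y). indicator ?B x * ?K (x - y) \<partial>?M) + (\<integral>\<^sup>+ (x, y). indicator ?B y * ?K (x - y) \<partial>?M)"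
      by (intro nn_integral_add) auto
    also have "\<dots> = emeasure lborel ?B * (\<integral>\<^sup>+ z. ?K z \<partial>lborel) + emeasure lborel ?B * (\<integral>\<^sup>+ z. ?K z \<partial>lborel)"
      by (subst nn_integral_tensor_kernel, simp, simp, simp add: kern_k_minus,
          subst nn_integral_tensor_kernel_snd) auto
    also have "\<dots> < \<infinity>"
      using second_moment_kern_k_finite[where 'a='a] \<rho> by (simp add: emeasure_ball ennreal_mult_less_top)
    finally show "(\<integral>\<^sup>+ p. ennreal (norm (case p of (x, y) \<Rightarrow> (?b x - ?b y) * (?b x - ?b y) * kern_k (x - y))) \<partial>?M) < \<infinity>" .
  qed measurable
  ultimately show ?thesis unfolding HH_iff using out by auto
qed

lemma mass_zeroD: assumes "u \<in> HH \<Omega>" "mass u = 0" shows "AE x in lborel. u x = 0"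
proof -
  have "AE x in lborel. u x * u x = 0"
    using integral_nonneg_eq_0_iff_AE[OF HH_square[OF assms(1)]] assms(2) by (simp add: ip_def)
  then show ?thesis by simp
qed

lemma not_AE_of_ball:
  assumes "0 < \<rho>" shows "\<not> (AE x in lborel. x \<notin> ball (x0::'a) \<rho>)"
proof
  assume "AE x in lborel. x \<notin> ball x0 \<rho>"
  then have "emeasure lborel (ball x0 \<rho>) = 0" by (subst (asm) AE_iff_null_sets[symmetric]) auto
  then show False using assms unit_ball_vol_pos[of "real DIM('a)"] by (simp add: emeasure_ball)
qed

text \<open>
The infimum that defines the minimax level is meaningful only if there is a path at all. Normalising
\<open>t \<phi> + (1 - \<bar>t\<bar>) b\<close> gives one, for a bump \<open>b\<close> that vanishes on some ball inside \<open>\<Omega>\<close>: on this ball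
\<open>\<phi> > 0\<close>, so the combination is nonzero for \<open>t \<noteq> 0\<close>; for \<open>t = 0\<close> it is the bump itself.
\<close>

lemma paths_nonempty:
  assumes \<phi>: "\<phi> \<in> HH \<Omega>" "mass \<phi> = 1" and pos: "AE x in lborel. x \<in> \<Omega> \<longrightarrow> 0 < \<phi> x"
  shows "paths \<Omega> \<phi> \<noteq> {}"
proof -
  have "\<Omega> \<noteq> {}"
  proof
    assume "\<Omega> = {}"
    then have "\<phi> = (\<lambda>x. 0)" using HH_outside[OF \<phi>(1)] by auto
    then show False using \<phi>(2) by (simp add: ip_def)
  qed
  then obtain x0 where "x0 \<in> \<Omega>" by blast
  then obtain e where e: "e > 0" "ball x0 e \<subseteq> \<Omega>" using open_dom open_contains_ball by blast
  define \<rho> where "\<rho> = e / 4"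
  have \<rho>: "\<rho> > 0" using e by (simp add: \<rho>_def)
  have "ball x0 \<rho> \<subseteq> \<Omega>" using e subset_ball[of \<rho> e x0] by (auto simp: \<rho>_def)
  define b where "b = (\<lambda>x. max 0 (\<rho> - dist x x0))"
  have b: "b \<in> HH \<Omega>" unfolding b_def using \<rho> \<open>ball x0 \<rho> \<subseteq> \<Omega>\<close> by (rule bump_HH)
  \<comment> \<open>The bump lives in \<open>ball x0 \<rho>\<close>; the translate of this ball by \<open>v\<close> is disjoint from it and still in \<open>\<Omega>\<close>.\<close>
  obtain v :: 'a where v: "norm v = 2 * \<rho>" using vector_choose_size[of "2 * \<rho>"] \<rho> by auto
  have far: "b x = 0" "x \<in> \<Omega>" if "x \<in> ball (x0 + v) \<rho>" for x
  proof -
    have d: "norm (x - (x0 + v)) < \<rho>" using that by (simp add: dist_norm norm_minus_commute)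
    have "norm v \<le> norm (x - x0) + norm (x - (x0 + v))"
      using norm_triangle_ineq4[of "x - x0" "x - (x0 + v)"] by simp
    then show "b x = 0" using d v \<rho> by (simp add: b_def dist_norm)
    have "norm (x - x0) \<le> norm (x - (x0 + v)) + norm v"
      using norm_triangle_ineq[of "x - (x0 + v)" v] by simp
    then have "x \<in> ball x0 e" using d v \<rho> by (simp add: \<rho>_def dist_norm norm_minus_commute)
    then show "x \<in> \<Omega>" using e by blast
  qed
  define w where "w = (\<lambda>t x. t * \<phi> x + (1 - \<bar>t\<bar>) * b x)"
  have w: "w t \<in> HH \<Omega>" for t unfolding w_def using \<phi>(1) b by (rule HH_combination)
  have pos_mass: "mass (w t) > 0" for t
  proof (rule ccontr)
    assume "\<not> mass (w t) > 0"
    then have "mass (w t) = 0" using mass_nonneg[of "w t"] by linarith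
    then have AE0: "AE x in lborel. w t x = 0" by (rule mass_zeroD[OF w])
    show False
    proof (cases "t = 0")
      case True
      have "AE x in lborel. x \<notin> ball x0 \<rho>"
        using AE0 by eventually_elim (auto simp: w_def b_def True dist_commute)
      then show False using not_AE_of_ball[OF \<rho>] by blast
    next
      case False
      have "AE x in lborel. x \<notin> ball (x0 + v) \<rho>"
        using AE0 pos
      proof eventually_elim
        case (elim x)
        show ?case
        proof
          assume "x \<in> ball (x0 + v) \<rho>"
          from far[OF this] elim False show False by (auto simp: w_def)
        qed
      qed
      then show False using not_AE_of_ball[OF \<rho>] by blast
    qed
  qed
  have mass_w: "mass (w t) = t\<^sup>2 * mass \<phi> + 2 * t * (1 - \<bar>t\<bar>) * ip \<phi> b + (1 - \<bar>t\<bar>)\<^sup>2 * mass b" for t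
    unfolding w_def by (rule mass_expand[OF \<phi>(1) b])
  have cont: "continuous_on {-1..1} (\<lambda>t. mass (w t))"
    unfolding mass_w by (intro continuous_intros)
  define \<gamma> where "\<gamma> = (\<lambda>t x. (t / sqrt (mass (w t))) * \<phi> x + ((1 - \<bar>t\<bar>) / sqrt (mass (w t))) * b x)"
  have \<gamma>w: "\<gamma> t = (\<lambda>x. (1 / sqrt (mass (w t))) * w t x + 0 * w t x)" for t
    by (auto simp: \<gamma>_def w_def add_divide_distrib)
  have "energy_path {-1..1} \<gamma>"
    unfolding \<gamma>_def
  proof (rule energy_path_combination[OF energy_path_const b])
    have "sqrt (mass (w t)) \<noteq> 0" for t using pos_mass[of t] by simp
    then show "continuous_on {-1..1} (\<lambda>t. t / sqrt (mass (w t)))"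
      "continuous_on {-1..1} (\<lambda>t. (1 - \<bar>t\<bar>) / sqrt (mass (w t)))"
      by (intro continuous_intros cont; simp)+
  qed (rule \<phi>)
  moreover have "mass (\<gamma> t) = 1" for t
    unfolding \<gamma>w mass_expand[OF w w] using pos_mass[of t] by (simp add: power_divide less_imp_le)
  moreover have "mass (w 1) = 1" "mass (w (-1)) = 1" by (simp_all add: mass_w \<phi>)
  then have "\<gamma> 1 = \<phi>" "\<gamma> (-1) = (\<lambda>x. - \<phi> x)" by (auto simp: \<gamma>_def)
  ultimately have "\<gamma> \<in> paths \<Omega> \<phi>" unfolding paths_iff by simp
  then show ?thesis by blast
qed

end

section \<open>Minimax levels\<close>

locale eigenpair = bounded_open \<Omega> for \<Omega> :: "'a::euclidean_space set" +
  fixes \<phi> :: "'a \<Rightarrow> real"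
  assumes eigen: "first_eigenfunction \<Omega> \<phi>"
begin

definition lam :: real where "lam = form_EL \<phi> \<phi>"

definition excess :: "('a \<Rightarrow> real) \<Rightarrow> real" where
  "excess u = form_EL u u - lam * mass u"

lemma phi_PP: "\<phi> \<in> PP \<Omega>" and phi_min: "u \<in> PP \<Omega> \<Longrightarrow> lam \<le> form_EL u u"
  and phi_pos: "AE x in lborel. x \<in> \<Omega> \<longrightarrow> 0 < \<phi> x"
  using eigen by (auto simp: first_eigenfunction_def is_arg_min_linorder lam_def)

lemma phi_HH: "\<phi> \<in> HH \<Omega>" and phi_mass: "mass \<phi> = 1"
  using phi_PP by (auto simp: PP_iff)

lemma phi_nonneg: "AE x in lborel. 0 \<le> \<phi> x"
  using phi_pos by eventually_elim (use HH_outside[OF phi_HH] in force)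

lemma excess_expand:
  assumes u: "u \<in> HH \<Omega>" and v: "v \<in> HH \<Omega>"
  shows "excess (\<lambda>x. a * u x + b * v x) =
    a\<^sup>2 * excess u + a * b * (form_EL u v + form_EL v u - 2 * lam * ip u v) + b\<^sup>2 * excess v"
  unfolding excess_def form_EL_expand[OF assms] mass_expand[OF assms] by (simp add: algebra_simps)

lemma excess_nonneg:
  assumes u: "u \<in> HH \<Omega>" shows "0 \<le> excess u"
proof (cases "mass u = 0")
  case True
  then show ?thesis
    using form_EL_form_E[OF u] form_E_nonneg[of u] by (simp add: excess_def)
next
  case False
  then have m: "mass u > 0" using mass_nonneg[of u] by linarith
  let ?s = "1 / sqrt (mass u)"
  let ?v = "\<lambda>x. ?s * u x + 0 * u x"
  have s: "?s\<^sup>2 = 1 / mass u" using m by (simp add: power_divide)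
  have v: "?v \<in> HH \<Omega>" using u u by (rule HH_combination)
  have "mass ?v = 1" unfolding mass_expand[OF u u] using s m by simp
  then have "lam \<le> form_EL ?v ?v" using v by (intro phi_min) (simp only: PP_iff)
  also have "\<dots> = form_EL u u / mass u"
    unfolding form_EL_expand[OF u u] using s by simp
  finally show ?thesis using m by (simp add: excess_def field_simps)
qed

lemma excess_phi: "excess \<phi> = 0" by (simp add: excess_def lam_def phi_mass)

lemma linear_nonneg_slope_zero:
  fixes q b :: real
  assumes "\<And>t. 0 \<le> q + t * b" shows "b = 0"
proof (rule ccontr)
  assume "b \<noteq> 0"
  then show False using assms[of "- (q + 1) / b"] by simp
qed

text \<open>
A nonnegative quadratic form that vanishes at \<open>\<phi>\<close> has no mixed term with \<open>\<phi>\<close>; otherwise it would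
be negative at \<open>u + t \<phi>\<close> for suitable \<open>t\<close>. This is the weak form of the eigenvalue equation.
\<close>

lemma excess_shift:
  assumes u: "u \<in> HH \<Omega>" shows "excess (\<lambda>x. a * u x + b * \<phi> x) = a\<^sup>2 * excess u"
proof -
  let ?X = "form_EL u \<phi> + form_EL \<phi> u - 2 * lam * ip u \<phi>"
  have "0 \<le> excess u + t * ?X" for t
    using excess_nonneg[OF HH_combination[OF u phi_HH, of 1 t]]
    unfolding excess_expand[OF u phi_HH] by (simp add: excess_phi)
  then have "?X = 0" by (rule linear_nonneg_slope_zero)
  then show ?thesis unfolding excess_expand[OF u phi_HH] by (simp add: excess_phi)
qed

lemma E_r_excess:
  assumes "u \<in> PP \<Omega>" shows "E_r \<Omega> r u = lam + excess u - r * mass (ppart u)"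
  using assms by (simp add: PP_iff E_r_eq excess_def)

lemma E_r_ge:
  assumes "u \<in> PP \<Omega>" shows "lam - \<bar>r\<bar> \<le> E_r \<Omega> r u"
proof -
  have u: "u \<in> HH \<Omega>" "mass u = 1" using assms by (auto simp: PP_iff)
  have "r * mass (ppart u) \<le> \<bar>r\<bar> * 1"
    using mass_ppart_le[OF u(1)] u(2) mass_nonneg[of "ppart u"] by (intro mult_mono) auto
  then show ?thesis unfolding E_r_excess[OF assms] using excess_nonneg[OF u(1)] by linarith
qed

lemma paths_D:
  assumes "\<gamma> \<in> paths \<Omega> \<phi>"
  shows path_energy: "energy_path {-1..1} \<gamma>" and path_PP: "\<And>t. t \<in> {-1..1} \<Longrightarrow> \<gamma> t \<in> PP \<Omega>"
    and path_start: "AE x in lborel. \<gamma> (-1) x = - \<phi> x" and path_end: "AE x in lborel. \<gamma> 1 x = \<phi> x"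
  using assms by (auto simp: paths_iff PP_iff energy_path_def)

text \<open>
By compactness of the parameter interval the maximum exists, so \<open>GREATEST\<close> denotes it and is not an
unspecified value.
\<close>

lemma path_max:
  assumes \<gamma>: "\<gamma> \<in> paths \<Omega> \<phi>"
  shows "\<exists>t\<in>{-1..1}. (GREATEST m. m \<in> E_r \<Omega> r ` \<gamma> ` {-1..1}) = E_r \<Omega> r (\<gamma> t) \<and>
    (\<forall>s\<in>{-1..1}. E_r \<Omega> r (\<gamma> s) \<le> E_r \<Omega> r (\<gamma> t))"
proof -
  obtain t where t: "t \<in> {-1..1}" "\<And>s. s \<in> {-1..1} \<Longrightarrow> E_r \<Omega> r (\<gamma> s) \<le> E_r \<Omega> r (\<gamma> t)"
    using continuous_attains_sup[OF _ _ energy_path_E_r_continuous[OF path_energy[OF \<gamma>], of r]] by auto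
  then have "(GREATEST m. m \<in> E_r \<Omega> r ` \<gamma> ` {-1..1}) = E_r \<Omega> r (\<gamma> t)"
    by (intro Greatest_equality) auto
  with t show ?thesis by blast
qed

lemma minimax_le:
  assumes \<gamma>: "\<gamma> \<in> paths \<Omega> \<phi>" and le: "\<And>t. t \<in> {-1..1} \<Longrightarrow> E_r \<Omega> r (\<gamma> t) \<le> m"
  shows "minimax_c \<Omega> \<phi> r \<le> m"
proof -
  have "bdd_below ((\<lambda>\<gamma>. GREATEST m. m \<in> E_r \<Omega> r ` \<gamma> ` {-1..1}) ` paths \<Omega> \<phi>)"
  proof (rule bdd_belowI2)
    fix \<gamma> assume "\<gamma> \<in> paths \<Omega> \<phi>"
    then show "lam - \<bar>r\<bar> \<le> (GREATEST m. m \<in> E_r \<Omega> r ` \<gamma> ` {-1..1})"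
      using path_max[of \<gamma> r] E_r_ge path_PP by metis
  qed
  then have "minimax_c \<Omega> \<phi> r \<le> (GREATEST m. m \<in> E_r \<Omega> r ` \<gamma> ` {-1..1})"
    unfolding minimax_c_def using \<gamma> by (rule cINF_lower)
  also have "\<dots> \<le> m" using path_max[OF \<gamma>, of r] le by auto
  finally show ?thesis .
qed

lemma minimax_ge:
  assumes "\<And>\<gamma>. \<gamma> \<in> paths \<Omega> \<phi> \<Longrightarrow> \<exists>t\<in>{-1..1}. m \<le> E_r \<Omega> r (\<gamma> t)"
  shows "m \<le> minimax_c \<Omega> \<phi> r"
  unfolding minimax_c_def
proof (rule cINF_greatest)
  show "paths \<Omega> \<phi> \<noteq> {}" using phi_HH phi_mass phi_pos by (rule paths_nonempty)
  fix \<gamma> assume \<gamma>: "\<gamma> \<in> paths \<Omega> \<phi>"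
  obtain t where "t \<in> {-1..1}" "m \<le> E_r \<Omega> r (\<gamma> t)" using assms[OF \<gamma>] by blast
  then show "m \<le> (GREATEST m. m \<in> E_r \<Omega> r ` \<gamma> ` {-1..1})"
    using path_max[OF \<gamma>, of r] by force
qed

lemma near_optimal_path:
  assumes "0 < \<epsilon>"
  shows "\<exists>\<gamma>\<in>paths \<Omega> \<phi>. \<forall>t\<in>{-1..1}. E_r \<Omega> r (\<gamma> t) \<le> minimax_c \<Omega> \<phi> r + \<epsilon>"
proof (rule ccontr)
  assume "\<not> ?thesis"
  then have "minimax_c \<Omega> \<phi> r + \<epsilon> \<le> minimax_c \<Omega> \<phi> r" by (intro minimax_ge) force
  then show False using assms by simp
qed

text \<open>
The path \<open>t \<mapsto> - \<gamma> (- t)\<close> is admissible, and \<open>E_r (- r) (- u) = r + E_r r u\<close> on the unit sphere.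
\<close>

lemma minimax_reflect_le: "minimax_c \<Omega> \<phi> (- r) \<le> r + minimax_c \<Omega> \<phi> r"
proof (rule field_le_epsilon)
  fix \<epsilon> :: real assume "0 < \<epsilon>"
  then obtain \<gamma> where \<gamma>: "\<gamma> \<in> paths \<Omega> \<phi>"
    and le: "\<And>t. t \<in> {-1..1} \<Longrightarrow> E_r \<Omega> r (\<gamma> t) \<le> minimax_c \<Omega> \<phi> r + \<epsilon>"
    using near_optimal_path by blast
  let ?\<delta> = "\<lambda>t x. - \<gamma> (- t) x"
  have HH: "\<gamma> t \<in> HH \<Omega>" "mass (\<gamma> t) = 1" if "t \<in> {-1..1}" for t
    using path_PP[OF \<gamma> that] by (auto simp: PP_iff)
  have lim: "((\<lambda>s. energy (\<lambda>x. \<gamma> s x - \<gamma> t x)) \<longlongrightarrow> 0) (at t within {-1..1})" if "t \<in> {-1..1}" for t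
    using path_energy[OF \<gamma>] that by (auto simp: energy_path_def)
  have energy_minus: "energy (\<lambda>x. - u x) = energy u" for u by (simp add: energy_def form_E_def mult.commute minus_diff_commute algebra_simps)
  have "energy_path {-1..1} ?\<delta>"
    unfolding energy_path_def
  proof (intro conjI ballI)
    fix t :: real assume t: "t \<in> {-1..1}"
    show "?\<delta> t \<in> HH \<Omega>" using HH(1)[of "- t"] t by (intro HH_uminus) auto
    have "filterlim (\<lambda>s::real. - s) (at (- t) within {-1..1}) (at t within {-1..1})"
      unfolding filterlim_at by (auto intro!: tendsto_intros simp: eventually_at_filter)
    from filterlim_compose[OF lim[of "- t"] this] t
    have "((\<lambda>s. energy (\<lambda>x. \<gamma> (- s) x - \<gamma> (- t) x)) \<longlongrightarrow> 0) (at t within {-1..1})" by auto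
    moreover have "energy (\<lambda>x. ?\<delta> s x - ?\<delta> t x) = energy (\<lambda>x. \<gamma> (- s) x - \<gamma> (- t) x)" for s
      using energy_minus[of "\<lambda>x. \<gamma> (- s) x - \<gamma> (- t) x"] by simp
    ultimately show "((\<lambda>s. energy (\<lambda>x. ?\<delta> s x - ?\<delta> t x)) \<longlongrightarrow> 0) (at t within {-1..1})"
      by simp
  qed
  then have \<delta>: "?\<delta> \<in> paths \<Omega> \<phi>"
    using path_start[OF \<gamma>] path_end[OF \<gamma>] HH(2) by (auto simp: paths_iff ip_def)
  have "E_r \<Omega> (- r) (?\<delta> t) \<le> r + minimax_c \<Omega> \<phi> r + \<epsilon>" if "t \<in> {-1..1}" for t
  proof -
    have t: "- t \<in> {-1..1}" using that by auto
    let ?u = "\<gamma> (- t)"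
    have u: "?u \<in> HH \<Omega>" by (rule HH(1)[OF t])
    have "form_EL (?\<delta> t) (?\<delta> t) = form_EL ?u ?u"
      using form_EL_expand[OF u u, of "-1" 0] by simp
    moreover have "mass (ppart ?u) + mass (ppart (?\<delta> t)) = mass ?u"
      using mass_split[OF u] by simp
    ultimately have "E_r \<Omega> (- r) (?\<delta> t) = r + E_r \<Omega> r ?u"
      using HH(2)[OF t] by (simp add: E_r_eq[OF u] E_r_eq[OF HH_uminus[OF u]] algebra_simps)
         (metis distrib_left mult.right_neutral)
    then show ?thesis using le[OF t] by simp
  qed
  then show "minimax_c \<Omega> \<phi> (- r) \<le> r + minimax_c \<Omega> \<phi> r + \<epsilon>" by (rule minimax_le[OF \<delta>])
qed

lemma minimax_reflect: "minimax_c \<Omega> \<phi> (- r) = r + minimax_c \<Omega> \<phi> r"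
  using minimax_reflect_le[of r] minimax_reflect_le[of "- r"] by simp

section \<open>The minimax levels lie above the first eigenvalue\<close>

text \<open>
Let \<open>p = u\<^sup>+\<close>, \<open>q = u\<^sup>-\<close> and \<open>mass p = \<sigma>\<^sup>2\<close>. Either \<open>form_EL p p\<close> is a large multiple of \<open>mass p\<close>,
and then \<open>excess p\<close> alone suffices; or \<open>excess u\<close> is at least \<open>R + 1\<close>; or neither holds, and then
\<open>L1_lower_bound\<close> applies to \<open>p\<close> and to \<open>u\<close>. In the last case \<open>\<integral> p \<ge> \<kappa> \<sigma>\<close> and
\<open>\<integral> q \<ge> \<kappa> / 2\<close>, so the interaction is of order \<open>\<sigma>\<close>, which dominates \<open>(R + 1) \<sigma>\<^sup>2\<close>.
\<close>

lemma barrier: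
  assumes R: "0 \<le> R"
  shows "\<exists>\<eta>. 0 < \<eta> \<and> \<eta> < 1 \<and> (\<forall>u\<in>PP \<Omega>. mass (ppart u) = \<eta> \<longrightarrow> (R + 1) * \<eta> \<le> excess u)"
proof -
  define M where "M = \<bar>lam\<bar> + R + 1"
  obtain \<kappa> where \<kappa>: "\<kappa> > 0"
    "\<And>u. u \<in> HH \<Omega> \<Longrightarrow> form_EL u u \<le> M * mass u \<Longrightarrow> \<kappa> * sqrt (mass u) \<le> (LINT x|lborel. \<bar>u x\<bar>)"
    using L1_lower_bound[of M] by blast
  obtain \<beta> where \<beta>: "\<beta> > 0" "\<And>u. u \<in> HH \<Omega> \<Longrightarrow>
     form_EL (ppart u) (ppart u) + form_EL (ppart (\<lambda>x. - u x)) (ppart (\<lambda>x. - u x)) +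
     \<beta> * (LINT x|lborel. ppart u x) * (LINT x|lborel. ppart (\<lambda>x. - u x) x) \<le> form_EL u u"
    using form_EL_split by blast
  define V where "V = sqrt (measure lborel \<Omega>)"
  have V: "V \<ge> 0" by (simp add: V_def)
  \<comment> \<open>The three bounds give \<open>\<sigma>\<^sup>2 < 1\<close>, \<open>\<integral> p \<le> \<kappa> / 2\<close>, and domination of the barrier height by the interaction.\<close>
  define \<sigma> where "\<sigma> = min (1/2) (min (\<kappa> / (2 * (V + 1))) (\<beta> * \<kappa>\<^sup>2 / (2 * (R + 1))))"
  have \<sigma>: "0 < \<sigma>" "\<sigma> \<le> 1/2"
    using V R \<kappa>(1) \<beta>(1) unfolding \<sigma>_def by (simp, intro min.cobounded1)
  have cancel: "x * (y / (2 * x)) = y / 2" if "x \<noteq> 0" for x y :: real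
    using that by simp
  have "V * \<sigma> \<le> (V + 1) * (\<kappa> / (2 * (V + 1)))"
    using V \<sigma> by (intro mult_mono) (auto simp: \<sigma>_def)
  also have "\<dots> = \<kappa> / 2" using V by (intro cancel) linarith
  finally have \<sigma>V: "V * \<sigma> \<le> \<kappa> / 2" .
  have "(R + 1) * \<sigma> \<le> (R + 1) * (\<beta> * \<kappa>\<^sup>2 / (2 * (R + 1)))"
    using R by (intro mult_left_mono) (auto simp: \<sigma>_def)
  also have "\<dots> = \<beta> * \<kappa>\<^sup>2 / 2" using R by (intro cancel) linarith
  finally have \<sigma>R: "(R + 1) * \<sigma> \<le> \<beta> * \<kappa>\<^sup>2 / 2" .
  have "(R + 1) * \<sigma>\<^sup>2 \<le> excess u" if u: "u \<in> PP \<Omega>" and P: "mass (ppart u) = \<sigma>\<^sup>2" for u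
  proof -
    have uH: "u \<in> HH \<Omega>" and u1: "mass u = 1" using u by (auto simp: PP_iff)
    define p q where "p = ppart u" and "q = ppart (\<lambda>x. - u x)"
    have p: "p \<in> HH \<Omega>" and q: "q \<in> HH \<Omega>"
      using HH_ppart[OF uH] HH_ppart[OF HH_uminus[OF uH]] by (simp_all add: p_def q_def)
    define Ip Iq where "Ip = (LINT x|lborel. p x)" and "Iq = (LINT x|lborel. q x)"
    have I0: "Ip \<ge> 0" "Iq \<ge> 0" by (auto simp: Ip_def Iq_def p_def q_def)
    have Ip: "(LINT x|lborel. \<bar>p x\<bar>) = Ip"
      unfolding Ip_def by (intro Bochner_Integration.integral_cong) (auto simp: p_def)
    have mp: "mass p = \<sigma>\<^sup>2" using P by (simp add: p_def)
    have "excess u \<ge> excess p + excess q + \<beta> * Ip * Iq"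
      using \<beta>(2)[OF uH] mass_split[OF uH] unfolding excess_def p_def q_def Ip_def Iq_def
      by (simp add: algebra_simps)
    then have ex: "excess u \<ge> excess p + \<beta> * Ip * Iq" using excess_nonneg[OF q] by linarith
    have exI: "excess u \<ge> excess p" "excess u \<ge> \<beta> * Ip * Iq"
      using ex excess_nonneg[OF p] mult_nonneg_nonneg[OF mult_nonneg_nonneg[OF less_imp_le[OF \<beta>(1)] I0(1)] I0(2)]
      by linarith+
    consider "form_EL p p > M * \<sigma>\<^sup>2" | "excess u \<ge> R + 1"
      | "form_EL p p \<le> M * \<sigma>\<^sup>2" "excess u < R + 1" by linarith
    then show ?thesis
    proof cases
      case 1
      have "(R + 1) * \<sigma>\<^sup>2 \<le> (M - lam) * \<sigma>\<^sup>2" by (intro mult_right_mono) (auto simp: M_def)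
      then show ?thesis using 1 exI(1) by (simp add: excess_def mp algebra_simps)
    next
      case 2
      have "\<sigma>\<^sup>2 \<le> 1" using \<sigma> by (simp add: power_le_one)
      then have "(R + 1) * \<sigma>\<^sup>2 \<le> R + 1" using R mult_left_mono[of "\<sigma>\<^sup>2" 1 "R + 1"] by simp
      then show ?thesis using 2 by linarith
    next
      case 3
      have lowp: "\<kappa> * \<sigma> \<le> Ip"
        using \<kappa>(2)[OF p] 3(1) \<sigma> by (simp add: mp Ip)
      have "form_EL u u \<le> M * mass u" using 3(2) by (simp add: excess_def u1 M_def)
      then have "\<kappa> \<le> (LINT x|lborel. \<bar>u x\<bar>)" using \<kappa>(2)[OF uH] u1 by simp
      also have "\<dots> = (LINT x|lborel. p x + q x)"
        by (intro Bochner_Integration.integral_cong) (auto simp: p_def q_def max_def)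
      also have "\<dots> = Ip + Iq"
        unfolding Ip_def Iq_def using HH_integrable[OF p] HH_integrable[OF q] by simp
      finally have \<kappa>le: "\<kappa> \<le> Ip + Iq" .
      have "Ip\<^sup>2 \<le> measure lborel \<Omega> * \<sigma>\<^sup>2" using L1_square_le_mass[OF p] by (simp add: mp Ip)
      also have "\<dots> = (V * \<sigma>)\<^sup>2" by (simp add: V_def power_mult_distrib)
      finally have "Ip\<^sup>2 \<le> (V * \<sigma>)\<^sup>2" .
      then have "Ip \<le> V * \<sigma>"
        by (rule power2_le_imp_le) (rule mult_nonneg_nonneg[OF V less_imp_le[OF \<sigma>(1)]])
      then have lowq: "\<kappa> / 2 \<le> Iq" using \<kappa>le \<sigma>V by linarith
      have "(R + 1) * \<sigma>\<^sup>2 \<le> \<beta> * \<kappa>\<^sup>2 / 2 * \<sigma>"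
        using mult_right_mono[OF \<sigma>R, of \<sigma>] \<sigma> by (simp add: power2_eq_square mult.assoc)
      also have "\<dots> = \<beta> * (\<kappa> * \<sigma>) * (\<kappa> / 2)" by (simp add: power2_eq_square)
      also have "\<dots> \<le> \<beta> * Ip * Iq"
      proof (rule mult_mono)
        show "\<beta> * (\<kappa> * \<sigma>) \<le> \<beta> * Ip" using lowp \<beta>(1) by simp
      qed (use lowq \<beta>(1) \<kappa>(1) I0 in simp_all)
      finally show ?thesis using exI(2) by linarith
    qed
  qed
  moreover have "\<sigma>\<^sup>2 < 1" using \<sigma> by (simp add: power_less_one_iff)
  ultimately show ?thesis using \<sigma>(1) by (intro exI[of _ "\<sigma>\<^sup>2"]) auto
qed

lemma path_ends:
  assumes \<gamma>: "\<gamma> \<in> paths \<Omega> \<phi>"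
  shows "mass (ppart (\<gamma> (-1))) = 0" "mass (ppart (\<gamma> 1)) = 1" "ip (\<gamma> (-1)) \<phi> = -1"
proof -
  have [measurable]: "\<gamma> (-1) \<in> borel_measurable borel" "\<gamma> 1 \<in> borel_measurable borel" "\<phi> \<in> borel_measurable borel"
    using path_PP[OF \<gamma>, of "-1"] path_PP[OF \<gamma>, of 1] phi_HH by (auto simp: PP_iff HH_measurable)
  show "mass (ppart (\<gamma> (-1))) = 0"
    unfolding ip_def using path_start[OF \<gamma>] phi_nonneg
    by (intro integral_eq_zero_AE) auto
  have "mass (ppart (\<gamma> 1)) = mass \<phi>"
    unfolding ip_def using path_end[OF \<gamma>] phi_nonneg
    by (intro integral_cong_AE) (measurable, auto)
  then show "mass (ppart (\<gamma> 1)) = 1" by (simp add: phi_mass)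
  have "ip (\<gamma> (-1)) \<phi> = (LINT x|lborel. - (\<phi> x * \<phi> x))"
    unfolding ip_def using path_start[OF \<gamma>]
    by (intro integral_cong_AE) (measurable, auto)
  then show "ip (\<gamma> (-1)) \<phi> = -1" using phi_mass by (simp add: ip_def)
qed

text \<open>
Along a path \<open>mass u\<^sup>+\<close> runs from 0 to 1, so it takes the value at which the barrier stands.
\<close>

lemma minimax_gt_lam: "lam < minimax_c \<Omega> \<phi> r"
proof -
  obtain \<eta> where \<eta>: "0 < \<eta>" "\<eta> < 1"
    and bar: "\<And>u. u \<in> PP \<Omega> \<Longrightarrow> mass (ppart u) = \<eta> \<Longrightarrow> (\<bar>r\<bar> + 1) * \<eta> \<le> excess u"
    using barrier[of "\<bar>r\<bar>"] by auto
  have "lam + \<eta> \<le> minimax_c \<Omega> \<phi> r"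
  proof (rule minimax_ge)
    fix \<gamma> assume \<gamma>: "\<gamma> \<in> paths \<Omega> \<phi>"
    obtain t where t: "-1 \<le> t" "t \<le> 1" "mass (ppart (\<gamma> t)) = \<eta>"
      using IVT'[of "\<lambda>t. mass (ppart (\<gamma> t))" "-1" \<eta> 1] path_ends[OF \<gamma>] \<eta>
        energy_path_continuous(2)[OF path_energy[OF \<gamma>]] by auto
    have u: "\<gamma> t \<in> PP \<Omega>" using path_PP[OF \<gamma>] t by auto
    have "r * \<eta> \<le> \<bar>r\<bar> * \<eta>" using \<eta> by (intro mult_right_mono) auto
    then have "lam + \<eta> \<le> E_r \<Omega> r (\<gamma> t)"
      unfolding E_r_excess[OF u] t(3) using bar[OF u t(3)] by (simp add: algebra_simps)
    then show "\<exists>t\<in>{-1..1}. lam + \<eta> \<le> E_r \<Omega> r (\<gamma> t)" using t by auto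
  qed
  then show ?thesis using \<eta> by linarith
qed

section \<open>Strict monotonicity\<close>

text \<open>
These sets decrease to a null set as \<open>\<theta>\<close> tends to zero, because \<open>\<phi> > 0\<close> almost everywhere.
\<close>

lemma phi_small_set:
  assumes "0 < \<epsilon>" shows "\<exists>\<theta>>0. measure lborel {x \<in> \<Omega>. \<phi> x < \<theta>} \<le> \<epsilon>"
proof -
  have [measurable]: "\<phi> \<in> borel_measurable borel" using phi_HH by (rule HH_measurable)
  define A where "A = (\<lambda>n::nat. {x \<in> \<Omega>. \<phi> x < 1 / real (Suc n)})"
  have [measurable]: "A n \<in> sets borel" for n unfolding A_def by measurable
  have "(\<lambda>n. measure lborel (A n)) \<longlonglongrightarrow> measure lborel (\<Inter>n. A n)"
  proof (rule Lim_measure_decseq)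
    show "decseq A"
      unfolding A_def decseq_def by (auto intro: order.strict_trans2 simp: frac_le)
    fix n
    have "emeasure lborel (A n) \<le> emeasure lborel \<Omega>" by (intro emeasure_mono) (auto simp: A_def)
    then show "emeasure lborel (A n) \<noteq> \<infinity>" using dom_finite by (auto simp: top_unique)
  qed auto
  moreover have "measure lborel (\<Inter>n. A n) = 0"
  proof -
    have "AE x in lborel. x \<notin> (\<Inter>n. A n)"
      using phi_pos
    proof eventually_elim
      case (elim x)
      show ?case
      proof
        assume x: "x \<in> (\<Inter>n. A n)"
        then have "x \<in> \<Omega>" by (auto simp: A_def)
        with elim obtain n where "1 / real (Suc n) < \<phi> x" using nat_approx_posE by blast
        moreover have "\<phi> x < 1 / real (Suc n)" using x by (auto simp: A_def)
        ultimately show False by simp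
      qed
    qed
    then have "(\<Inter>n. A n) \<in> null_sets lborel" by (subst AE_iff_null_sets) auto
    then show ?thesis by (simp add: measure_def null_setsD1)
  qed
  ultimately have "\<forall>\<^sub>F n in sequentially. measure lborel (A n) < \<epsilon>"
    using assms by (intro order_tendstoD(2)[where y = "measure lborel (\<Inter>n. A n)"]) auto
  then obtain n where "measure lborel (A n) < \<epsilon>" by (auto simp: eventually_sequentially)
  then show ?thesis unfolding A_def by (intro exI[of _ "1 / real (Suc n)"]) auto
qed

text \<open>
By \<open>L1_lower_bound\<close> the integral of \<open>\<bar>u\<bar>\<close> is at least \<open>k\<close>. The set where \<open>\<phi>\<close> is small has small
measure and carries at most half of it, so \<open>\<langle>\<bar>u\<bar>, \<phi>\<rangle>\<close> is bounded below. Finally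
\<open>u = 2 u\<^sup>+ - \<bar>u\<bar>\<close>, and \<open>\<langle>u\<^sup>+, \<phi>\<rangle>\<close> is at most \<open>\<surd>(mass u\<^sup>+)\<close>.
\<close>

lemma overlap_with_phi:
  "\<exists>\<kappa>>0. \<exists>\<eta>>0. \<forall>u\<in>PP \<Omega>. form_EL u u \<le> M \<longrightarrow> mass (ppart u) \<le> \<eta> \<longrightarrow> ip u \<phi> \<le> - \<kappa>"
proof -
  obtain k where k: "k > 0"
    "\<And>u. u \<in> HH \<Omega> \<Longrightarrow> form_EL u u \<le> M * mass u \<Longrightarrow> k * sqrt (mass u) \<le> (LINT x|lborel. \<bar>u x\<bar>)"
    using L1_lower_bound[of M] by blast
  \<comment> \<open>With this choice the set where \<open>\<phi>\<close> is small carries at most \<open>\<tau> = k / 2\<close> of the integral of \<open>\<bar>u\<bar>\<close>.\<close>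
  define \<tau> where "\<tau> = k / 2"
  have \<tau>: "\<tau> > 0" using k by (simp add: \<tau>_def)
  obtain \<theta> where \<theta>: "\<theta> > 0" "measure lborel {x \<in> \<Omega>. \<phi> x < \<theta>} \<le> \<tau>\<^sup>2"
    using phi_small_set[of "\<tau>\<^sup>2"] \<tau> by auto
  let ?A = "{x \<in> \<Omega>. \<phi> x < \<theta>}"
  have [measurable]: "\<phi> \<in> borel_measurable borel" using phi_HH by (rule HH_measurable)
  have A: "?A \<in> sets borel" by measurable
  have Afin: "emeasure lborel ?A < \<infinity>"
    using emeasure_mono[of ?A \<Omega> lborel] dom_finite by auto
  define K where "K = \<theta> * k / 4"
  have K: "K > 0" using k \<theta> by (simp add: K_def)
  have "ip u \<phi> \<le> - K" if u: "u \<in> PP \<Omega>" and M: "form_EL u u \<le> M" and P: "mass (ppart u) \<le> (K / 2)\<^sup>2" for u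
  proof -
    have uH: "u \<in> HH \<Omega>" and u1: "mass u = 1" using u by (auto simp: PP_iff)
    let ?a = "\<lambda>x. \<bar>u x\<bar>"
    have aH: "?a \<in> HH \<Omega>" using uH by (rule HH_abs)
    have iA: "integrable lborel (indicator ?A :: 'a \<Rightarrow> real)"
      using A Afin by (simp add: integrable_indicator_iff)
    have "k \<le> (LINT x|lborel. ?a x)" using k(2)[OF uH] M u1 by simp
    also have "\<dots> \<le> (LINT x|lborel. (1 / \<theta>) * (?a x * \<phi> x) + ((\<tau> / 2) * (u x * u x) + (1 / (2 * \<tau>)) * indicator ?A x))"
    proof (rule integral_mono_AE)
      show "integrable lborel ?a" using aH by (rule HH_integrable)
      show "integrable lborel (\<lambda>x. (1 / \<theta>) * (?a x * \<phi> x) + ((\<tau> / 2) * (u x * u x) + (1 / (2 * \<tau>)) * indicator ?A x))"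
        using ip_integrable[OF aH phi_HH] HH_square[OF uH] iA
        by (intro Bochner_Integration.integrable_add integrable_mult_right)
      show "AE x in lborel. ?a x \<le> (1 / \<theta>) * (?a x * \<phi> x) + ((\<tau> / 2) * (u x * u x) + (1 / (2 * \<tau>)) * indicator ?A x)"
        using phi_nonneg
      proof eventually_elim
        case (elim x)
        consider "x \<notin> \<Omega>" | "x \<in> ?A" | "x \<in> \<Omega>" "x \<notin> ?A" by blast
        then show ?case
        proof cases
          case 1
          then show ?thesis using HH_outside[OF uH] by simp
        next
          case 2
          have "0 \<le> (\<tau> * ?a x - 1)\<^sup>2" by simp
          then have "?a x \<le> (\<tau> / 2) * (u x * u x) + 1 / (2 * \<tau>)"
            using \<tau> by (simp add: power2_eq_square field_simps)
          moreover have "0 \<le> (1 / \<theta>) * (?a x * \<phi> x)" using elim \<theta>(1) by simp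
          ultimately show ?thesis using 2 by simp
        next
          case 3
          then have "\<theta> \<le> \<phi> x" by simp
          then have "?a x \<le> (1 / \<theta>) * (?a x * \<phi> x)"
            using \<theta>(1) mult_left_mono[of \<theta> "\<phi> x" "?a x"] by (simp add: field_simps)
          moreover have "0 \<le> (\<tau> / 2) * (u x * u x)" using \<tau> by simp
          ultimately show ?thesis using 3 by simp
        qed
      qed
    qed
    also have "\<dots> = (1 / \<theta>) * ip ?a \<phi> + ((\<tau> / 2) * mass u + (1 / (2 * \<tau>)) * measure lborel ?A)"
      unfolding ip_def using ip_integrable[OF aH phi_HH] HH_square[OF uH] iA by simp
    also have "(1 / (2 * \<tau>)) * measure lborel ?A \<le> (1 / (2 * \<tau>)) * \<tau>\<^sup>2"
      using \<theta>(2) \<tau> by (intro mult_left_mono) auto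
    finally have "k \<le> (1 / \<theta>) * ip ?a \<phi> + (\<tau> / 2 + \<tau> / 2)"
      using \<tau> u1 by (simp add: power2_eq_square)
    then have "k / 2 \<le> (1 / \<theta>) * ip ?a \<phi>" unfolding \<tau>_def by linarith
    then have a: "2 * K \<le> ip ?a \<phi>" using \<theta>(1) by (simp add: K_def field_simps)
    have "u = (\<lambda>x. 2 * ppart u x + (-1) * ?a x)" by (auto simp: max_def)
    then have "ip u \<phi> = 2 * ip (ppart u) \<phi> + (-1) * ip ?a \<phi>"
      using ip_combination[OF HH_ppart[OF uH] aH phi_HH, of 2 "-1"] by simp
    moreover have "ip (ppart u) \<phi> \<le> sqrt (mass (ppart u))"
      using ip_le_1[OF HH_ppart[OF uH] phi_HH] phi_mass by simp
    moreover have "sqrt (mass (ppart u)) \<le> K / 2"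
      using real_sqrt_le_mono[OF P] K by simp
    ultimately show ?thesis using a by linarith
  qed
  then show ?thesis using K by (intro exI[of _ K] conjI exI[of _ "(K / 2)\<^sup>2"]) auto
qed

text \<open>
Subtracting \<open>s \<phi>\<close> removes only part of the positive part: pointwise,
\<open>((u - s \<phi>)\<^sup>+)\<^sup>2 \<ge> (u\<^sup>+)\<^sup>2 - 2 s \<phi> u\<^sup>+\<close>.
\<close>

lemma ppart_shift_mass:
  assumes u: "u \<in> HH \<Omega>" and s: "0 \<le> s"
  shows "mass (ppart (\<lambda>x. u x - s * \<phi> x)) \<le> mass (ppart u)"
    and "mass (ppart u) - 2 * s * sqrt (mass (ppart u)) \<le> mass (ppart (\<lambda>x. u x - s * \<phi> x))"
proof -
  let ?w = "\<lambda>x. u x - s * \<phi> x"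
  have w: "?w \<in> HH \<Omega>" using HH_combination[OF u phi_HH, of 1 "- s"] by simp
  have int: "integrable lborel (\<lambda>x. ppart u x * ppart u x)" "integrable lborel (\<lambda>x. ppart ?w x * ppart ?w x)"
    "integrable lborel (\<lambda>x. ppart u x * \<phi> x)"
    using HH_square[OF HH_ppart[OF u]] HH_square[OF HH_ppart[OF w]] ip_integrable[OF HH_ppart[OF u] phi_HH] .
  show "mass (ppart ?w) \<le> mass (ppart u)"
    unfolding ip_def
  proof (rule integral_mono_AE[OF int(2,1)])
    show "AE x in lborel. ppart ?w x * ppart ?w x \<le> ppart u x * ppart u x"
      using phi_nonneg
    proof eventually_elim
      case (elim x)
      then have "?w x \<le> u x" using s by simp
      then show ?case by (intro mult_mono) auto
    qed
  qed
  have "mass (ppart u) - 2 * s * ip (ppart u) \<phi> = (LINT x|lborel. ppart u x * ppart u x - 2 * s * (ppart u x * \<phi> x))"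
    unfolding ip_def using int by simp
  also have "\<dots> \<le> mass (ppart ?w)"
    unfolding ip_def
  proof (rule integral_mono_AE)
    show "AE x in lborel. ppart u x * ppart u x - 2 * s * (ppart u x * \<phi> x) \<le> ppart ?w x * ppart ?w x"
      using phi_nonneg
    proof eventually_elim
      case (elim x)
      have s\<phi>: "0 \<le> s * \<phi> x" using s elim by simp
      show ?case
      proof (cases "u x \<le> s * \<phi> x")
        case True
        show ?thesis
        proof (cases "u x \<le> 0")
          case False
          have "u x * u x \<le> u x * (s * \<phi> x)" using True False by (intro mult_left_mono) auto
          moreover have "0 \<le> u x * (s * \<phi> x)" using s\<phi> False by simp
          moreover have "2 * s * (u x * \<phi> x) = 2 * (u x * (s * \<phi> x))" by simp
          ultimately have "u x * u x - 2 * s * (u x * \<phi> x) \<le> 0" by linarith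
          then show ?thesis using True False by (simp add: max_def)
        qed (use True in \<open>simp add: max_def\<close>)
      next
        case False
        have "?w x * ?w x = u x * u x - 2 * s * (u x * \<phi> x) + (s * \<phi> x) * (s * \<phi> x)"
          by (simp add: algebra_simps)
        then show ?thesis using False s\<phi> by (simp add: max_def)
      qed
    qed
  qed (use int in auto)
  finally have "mass (ppart u) - 2 * s * ip (ppart u) \<phi> \<le> mass (ppart ?w)" .
  moreover have "s * ip (ppart u) \<phi> \<le> s * sqrt (mass (ppart u))"
    using ip_le_1[OF HH_ppart[OF u] phi_HH] phi_mass s by (intro mult_left_mono) auto
  ultimately show "mass (ppart u) - 2 * s * sqrt (mass (ppart u)) \<le> mass (ppart ?w)" by simp
qed

text \<open>
Normalising \<open>u - s \<phi>\<close> gives a new admissible path: at \<open>- \<phi>\<close> the shift only rescales, and at \<open>\<phi>\<close> it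
is switched off by \<open>s 1 = 0\<close>. The sign condition on \<open>s \<langle>u, \<phi>\<rangle>\<close> keeps the norm \<open>d\<close> at least 1.
\<close>

lemma deform_path:
  assumes \<gamma>: "\<gamma> \<in> paths \<Omega> \<phi>" and s: "continuous_on {-1..1} s"
    and s0: "\<And>t. t \<in> {-1..1} \<Longrightarrow> 0 \<le> s t" and s1: "s 1 = 0"
    and sa: "\<And>t. t \<in> {-1..1} \<Longrightarrow> s t * ip (\<gamma> t) \<phi> \<le> 0"
  defines "d \<equiv> \<lambda>t. sqrt (1 - 2 * s t * ip (\<gamma> t) \<phi> + (s t)\<^sup>2)"
  shows "(\<lambda>t x. (1 / d t) * \<gamma> t x + (- s t / d t) * \<phi> x) \<in> paths \<Omega> \<phi>"
    and "\<And>t r. t \<in> {-1..1} \<Longrightarrow> E_r \<Omega> r (\<lambda>x. (1 / d t) * \<gamma> t x + (- s t / d t) * \<phi> x) =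
      lam + (excess (\<gamma> t) - r * mass (ppart (\<lambda>x. \<gamma> t x - s t * \<phi> x))) / (d t)\<^sup>2"
proof -
  let ?\<delta> = "\<lambda>t x. (1 / d t) * \<gamma> t x + (- s t / d t) * \<phi> x"
  have HH: "\<gamma> t \<in> HH \<Omega>" and m1: "mass (\<gamma> t) = 1" if "t \<in> {-1..1}" for t
    using path_PP[OF \<gamma> that] by (auto simp: PP_iff)
  have dsq: "(d t)\<^sup>2 = 1 - 2 * s t * ip (\<gamma> t) \<phi> + (s t)\<^sup>2" "d t \<ge> 1" if "t \<in> {-1..1}" for t
  proof -
    have "1 \<le> 1 - 2 * s t * ip (\<gamma> t) \<phi> + (s t)\<^sup>2"
      using sa[OF that] zero_le_power2[of "s t"] unfolding mult.assoc by linarith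
    then show "(d t)\<^sup>2 = 1 - 2 * s t * ip (\<gamma> t) \<phi> + (s t)\<^sup>2" "d t \<ge> 1"
      by (simp_all add: d_def)
  qed
  have path: "energy_path {-1..1} ?\<delta>"
  proof (rule energy_path_combination[OF path_energy[OF \<gamma>] phi_HH])
    have cd: "continuous_on {-1..1} d"
      unfolding d_def
      by (intro continuous_intros s energy_path_continuous(3)[OF path_energy[OF \<gamma>] phi_HH])
    have "\<forall>t\<in>{-1..1}. d t \<noteq> 0" using dsq(2) by force
    then show "continuous_on {-1..1} (\<lambda>t. 1 / d t)" "continuous_on {-1..1} (\<lambda>t. - s t / d t)"
      by (intro continuous_intros cd s; simp)+
  qed
  have mass: "mass (?\<delta> t) = 1" if t: "t \<in> {-1..1}" for t
  proof -
    have "mass (?\<delta> t) = (1 - 2 * s t * ip (\<gamma> t) \<phi> + (s t)\<^sup>2) / (d t)\<^sup>2"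
      unfolding mass_expand[OF HH[OF t] phi_HH] m1[OF t] phi_mass
      by (simp add: power2_eq_square add_divide_distrib diff_divide_distrib)
    also have "\<dots> = 1" using dsq[OF t] by (simp flip: dsq(1)[OF t])
    finally show ?thesis .
  qed
  have s_end: "1 + s (-1) > 0" "d (-1) = 1 + s (-1)" "d 1 = 1"
  proof -
    show "1 + s (-1) > 0" using s0[of "-1"] by simp
    have "1 + 2 * s (-1) + (s (-1))\<^sup>2 = (1 + s (-1))\<^sup>2" by (simp add: power2_eq_square algebra_simps)
    then show "d (-1) = 1 + s (-1)" using s0[of "-1"] path_ends(3)[OF \<gamma>] by (simp add: d_def)
    show "d 1 = 1" using s1 by (simp add: d_def)
  qed
  have "AE x in lborel. ?\<delta> (-1) x = - \<phi> x"
    using path_start[OF \<gamma>]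
  proof eventually_elim
    case (elim x)
    have "?\<delta> (-1) x = - ((1 + s (-1)) * \<phi> x / (1 + s (-1)))"
      unfolding elim s_end(2) by (simp add: distrib_right add_divide_distrib)
    then show ?case using s_end(1) by simp
  qed
  moreover have "AE x in lborel. ?\<delta> 1 x = \<phi> x"
    using path_end[OF \<gamma>] by eventually_elim (simp add: s_end s1)
  ultimately show "?\<delta> \<in> paths \<Omega> \<phi>" using path mass by (simp add: paths_iff)
  fix t :: real and r assume t: "t \<in> {-1..1}"
  have d: "d t > 0" using dsq(2)[OF t] by linarith
  have \<delta>: "?\<delta> t \<in> PP \<Omega>" unfolding PP_iff using mass[OF t] HH_combination[OF HH[OF t] phi_HH] by blast
  have "excess (?\<delta> t) = excess (\<gamma> t) / (d t)\<^sup>2"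
    unfolding excess_shift[OF HH[OF t]] by (simp add: power_divide)
  moreover have "mass (ppart (?\<delta> t)) = mass (ppart (\<lambda>x. \<gamma> t x - s t * \<phi> x)) / (d t)\<^sup>2"
  proof -
    have "ppart (?\<delta> t) x = ppart (\<lambda>x. \<gamma> t x - s t * \<phi> x) x / d t" for x
    proof -
      have "?\<delta> t x = (\<gamma> t x - s t * \<phi> x) / d t" by (simp add: diff_divide_distrib)
      then show ?thesis using d by (auto simp: max_def divide_le_0_iff)
    qed
    then show ?thesis by (simp add: ip_def power2_eq_square)
  qed
  ultimately show "E_r \<Omega> r (?\<delta> t) =
      lam + (excess (\<gamma> t) - r * mass (ppart (\<lambda>x. \<gamma> t x - s t * \<phi> x))) / (d t)\<^sup>2"
    unfolding E_r_excess[OF \<delta>] by (simp add: diff_divide_distrib)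
qed

text \<open>
The deformation is applied to an almost optimal path for \<open>r\<close> with \<open>s = max 0 (\<eta> - mass u\<^sup>+)\<close>.
Write \<open>P = mass u\<^sup>+\<close>. Raising \<open>r\<close> to \<open>r'\<close> gains \<open>(r' - r) P\<close>; normalising gains \<open>2 h \<kappa> s\<close>, where
\<open>h = c(r) - \<lambda>\<^sub>1\<close>; the loss of positive part costs at most \<open>2 R s \<surd>P \<le> h \<kappa> s\<close>, by the choice of
\<open>\<eta>\<close>. As \<open>P + s \<ge> \<eta>\<close>, the net gain is bounded below.
\<close>

lemma minimax_strict:
  assumes rr: "r < r'" shows "minimax_c \<Omega> \<phi> r' < minimax_c \<Omega> \<phi> r"
proof -
  define c where "c = minimax_c \<Omega> \<phi> r"
  define h where "h = c - lam"
  have h: "h > 0" using minimax_gt_lam[of r] by (simp add: h_def c_def)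
  define R where "R = \<bar>r\<bar> + \<bar>r'\<bar>"
  have R: "R \<ge> 0" "\<bar>r'\<bar> \<le> R" "\<bar>r\<bar> \<le> R" by (auto simp: R_def)
  obtain \<kappa> \<eta>0 where \<kappa>: "\<kappa> > 0" and \<eta>0: "\<eta>0 > 0"
    and ov: "\<And>u. u \<in> PP \<Omega> \<Longrightarrow> form_EL u u \<le> c + 1 + R \<Longrightarrow> mass (ppart u) \<le> \<eta>0 \<Longrightarrow> ip u \<phi> \<le> - \<kappa>"
    using overlap_with_phi[of "c + 1 + R"] by blast
  \<comment> \<open>\<open>\<surd>\<eta> \<le> \<sigma>\<close> is what makes the loss of positive part at most half of the normalisation gain.\<close>
  define \<sigma> where "\<sigma> = h * \<kappa> / (2 * R + 1)"
  have \<sigma>: "\<sigma> > 0" using h \<kappa> R by (simp add: \<sigma>_def)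
  have "2 * R * \<sigma> \<le> (2 * R + 1) * \<sigma>" using \<sigma> by (intro mult_right_mono) auto
  also have "\<dots> = h * \<kappa>" using R by (simp add: \<sigma>_def)
  finally have \<sigma>R: "2 * R * \<sigma> \<le> h * \<kappa>" .
  define \<eta> where "\<eta> = min 1 (min \<eta>0 (\<sigma>\<^sup>2))"
  have \<eta>: "0 < \<eta>" "\<eta> \<le> 1" "\<eta> \<le> \<eta>0" "\<eta> \<le> \<sigma>\<^sup>2" using \<eta>0 \<sigma> by (auto simp: \<eta>_def)
  define g where "g = min (r' - r) (h * \<kappa>)"
  have g: "g > 0" "g \<le> r' - r" "g \<le> h * \<kappa>" using rr h \<kappa> by (auto simp: g_def)
  \<comment> \<open>One \<open>e\<close> pays for the path being only almost optimal, four for the strict gap, as \<open>(d t)\<^sup>2 \<le> 4\<close>.\<close>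
  define e where "e = min 1 (g * \<eta> / 5)"
  have e: "e > 0" "e \<le> 1" "5 * e \<le> g * \<eta>" using g \<eta> by (auto simp: e_def)
  obtain \<gamma> where \<gamma>: "\<gamma> \<in> paths \<Omega> \<phi>" and le: "\<And>t. t \<in> {-1..1} \<Longrightarrow> E_r \<Omega> r (\<gamma> t) \<le> c + e"
    using near_optimal_path[OF e(1), of r] by (auto simp: c_def)
  define P where "P = (\<lambda>t. mass (ppart (\<gamma> t)))"
  define s where "s = (\<lambda>t. max 0 (\<eta> - P t))"
  have s_cont: "continuous_on {-1..1} s"
    unfolding s_def P_def by (intro continuous_intros energy_path_continuous(2)[OF path_energy[OF \<gamma>]])
  have P0: "0 \<le> P t" for t by (simp add: P_def mass_nonneg)
  have s01: "0 \<le> s t" "s t \<le> 1" for t using P0[of t] \<eta> by (auto simp: s_def)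
  have HH: "\<gamma> t \<in> HH \<Omega>" and m1: "mass (\<gamma> t) = 1" if "t \<in> {-1..1}" for t
    using path_PP[OF \<gamma> that] by (auto simp: PP_iff)
  have P1: "P t \<le> 1" if "t \<in> {-1..1}" for t
    using mass_ppart_le[OF HH[OF that]] m1[OF that] by (simp add: P_def)
  have ex: "excess (\<gamma> t) \<le> h + e + r * P t" if "t \<in> {-1..1}" for t
    using le[OF that] unfolding E_r_excess[OF path_PP[OF \<gamma> that]] by (simp add: h_def P_def)
  have overlap: "s t * ip (\<gamma> t) \<phi> \<le> - (\<kappa> * s t)" if t: "t \<in> {-1..1}" for t
  proof (cases "P t < \<eta>")
    case True
    have "r * P t \<le> R * 1" using R P0[of t] P1[OF t] by (intro mult_mono) auto
    then have "form_EL (\<gamma> t) (\<gamma> t) \<le> c + 1 + R"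
      using ex[OF t] e(2) by (simp add: excess_def m1[OF t] h_def)
    then have "ip (\<gamma> t) \<phi> \<le> - \<kappa>"
      using True \<eta>(3) by (intro ov path_PP[OF \<gamma> t]) (auto simp: P_def)
    then show ?thesis using mult_left_mono[of "ip (\<gamma> t) \<phi>" "- \<kappa>" "s t"] s01[of t] by (simp add: mult.commute)
  qed (simp add: s_def)
  have sa: "s t * ip (\<gamma> t) \<phi> \<le> 0" if t: "t \<in> {-1..1}" for t
    using overlap[OF t] mult_nonneg_nonneg[of \<kappa> "s t"] \<kappa> s01[of t] by linarith
  have s1: "s 1 = 0" using path_ends(2)[OF \<gamma>] \<eta>(2) by (simp add: s_def P_def)
  define d where "d = (\<lambda>t. sqrt (1 - 2 * s t * ip (\<gamma> t) \<phi> + (s t)\<^sup>2))"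
  have deformed: "(\<lambda>t x. (1 / d t) * \<gamma> t x + (- s t / d t) * \<phi> x) \<in> paths \<Omega> \<phi>"
    unfolding d_def by (rule deform_path(1)[OF \<gamma> s_cont s01(1) s1]) (rule sa)
  have deformed_level: "E_r \<Omega> r' (\<lambda>x. (1 / d t) * \<gamma> t x + (- s t / d t) * \<phi> x) =
      lam + (excess (\<gamma> t) - r' * mass (ppart (\<lambda>x. \<gamma> t x - s t * \<phi> x))) / (d t)\<^sup>2"
    if "t \<in> {-1..1}" for t
    unfolding d_def by (rule deform_path(2)[OF \<gamma> s_cont s01(1) s1 _ that]) (rule sa)
  have "minimax_c \<Omega> \<phi> r' \<le> lam + (h - e)"
  proof (rule minimax_le[OF deformed])
    fix t :: real assume t: "t \<in> {-1..1}"
    let ?a = "ip (\<gamma> t) \<phi>" and ?m = "mass (ppart (\<lambda>x. \<gamma> t x - s t * \<phi> x))"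
    have "0 \<le> (s t)\<^sup>2" by simp
    have dd: "(d t)\<^sup>2 = 1 - 2 * (s t * ?a) + (s t)\<^sup>2"
      using sa[OF t] \<open>0 \<le> (s t)\<^sup>2\<close> unfolding d_def
      by (subst real_sqrt_pow2) (auto simp: mult.assoc)
    have d_ge: "1 + 2 * (\<kappa> * s t) \<le> (d t)\<^sup>2" using overlap[OF t] \<open>0 \<le> (s t)\<^sup>2\<close> dd by linarith
    have d_pos: "(d t)\<^sup>2 \<ge> 1" using sa[OF t] \<open>0 \<le> (s t)\<^sup>2\<close> dd by linarith
    have "\<bar>?a\<bar> \<le> 1" using ip_le_1[OF HH[OF t] phi_HH] m1[OF t] phi_mass by simp
    then have "\<bar>s t\<bar> * \<bar>?a\<bar> \<le> 1 * 1" using s01[of t] by (intro mult_mono) auto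
    then have "- (s t * ?a) \<le> 1" by (simp add: abs_mult[symmetric])
    moreover have "(s t)\<^sup>2 \<le> 1" using s01[of t] by (simp add: power_le_one)
    ultimately have d_le: "(d t)\<^sup>2 \<le> 4" using dd by simp
    have step1: "- r' * ?m \<le> - r' * P t + h * \<kappa> * s t"
    proof (cases "0 \<le> r'")
      case True
      have "R * (2 * s t * sqrt (P t)) \<le> h * \<kappa> * s t"
      proof (cases "P t < \<eta>")
        case True
        have "sqrt (P t) \<le> \<sigma>" using True \<eta>(4) \<sigma> P0[of t] by (intro real_le_lsqrt) auto
        then have "(2 * R * s t) * sqrt (P t) \<le> (2 * R * s t) * \<sigma>"
          using R s01[of t] by (intro mult_left_mono) auto
        also have "\<dots> = (2 * R * \<sigma>) * s t" by simp
        also have "\<dots> \<le> h * \<kappa> * s t" using \<sigma>R s01[of t] by (intro mult_right_mono) auto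
        finally show ?thesis by (simp add: mult_ac)
      qed (simp add: s_def)
      moreover have "r' * (2 * s t * sqrt (P t)) \<le> R * (2 * s t * sqrt (P t))"
        using R s01[of t] P0[of t] by (intro mult_right_mono) auto
      moreover have "r' * (P t - 2 * s t * sqrt (P t)) \<le> r' * ?m"
        using ppart_shift_mass(2)[OF HH[OF t] s01(1)] True by (intro mult_left_mono) (auto simp: P_def)
      ultimately show ?thesis by (simp add: right_diff_distrib)
    next
      case False
      have "- r' * ?m \<le> - r' * P t"
        using ppart_shift_mass(1)[OF HH[OF t] s01(1)] False by (intro mult_left_mono) (auto simp: P_def)
      moreover have "0 \<le> h * \<kappa> * s t" using h \<kappa> s01[of t] by simp
      ultimately show ?thesis by linarith
    qed
    have gain: "g * \<eta> \<le> (r' - r) * P t + h * \<kappa> * s t"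
    proof -
      have "g * \<eta> \<le> g * (P t + s t)" using g(1) by (intro mult_left_mono) (auto simp: s_def)
      also have "\<dots> \<le> (r' - r) * P t + h * \<kappa> * s t"
        unfolding distrib_left using g P0[of t] s01[of t] by (intro add_mono mult_right_mono) auto
      finally show ?thesis .
    qed
    have "h + 2 * (h * \<kappa> * s t) \<le> h * (d t)\<^sup>2"
      using mult_left_mono[OF d_ge, of h] h by (simp add: distrib_left mult_ac)
    moreover have "e * (d t)\<^sup>2 \<le> e * 4" using d_le e by (intro mult_left_mono) auto
    moreover have "excess (\<gamma> t) - r' * ?m \<le> h + e - (r' - r) * P t + h * \<kappa> * s t"
      using ex[OF t] step1 by (simp add: left_diff_distrib)
    ultimately have "excess (\<gamma> t) - r' * ?m \<le> (h - e) * (d t)\<^sup>2"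
      using gain e(3) unfolding left_diff_distrib by linarith
    then have "(excess (\<gamma> t) - r' * ?m) / (d t)\<^sup>2 \<le> h - e"
      using d_pos by (subst pos_divide_le_eq) linarith+
    then show "E_r \<Omega> r' (\<lambda>x. (1 / d t) * \<gamma> t x + (- s t / d t) * \<phi> x) \<le> lam + (h - e)"
      unfolding deformed_level[OF t] by simp
  qed
  then show ?thesis using e(1) by (simp add: h_def c_def)
qed

end

theorem proposition5p5:
  fixes \<Omega> :: "'a::euclidean_space set" and \<phi>1 :: "'a \<Rightarrow> real"
  assumes "bounded_C11_domain \<Omega>"
    and "first_eigenfunction \<Omega> \<phi>1"
  shows "continuous_on {0..} (\<lambda>r. (r + minimax_c \<Omega> \<phi>1 r, minimax_c \<Omega> \<phi>1 r)) \<and>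
    (\<forall>r r'. 0 \<le> r \<and> r < r' \<longrightarrow>
       r + minimax_c \<Omega> \<phi>1 r < r' + minimax_c \<Omega> \<phi>1 r' \<and>
       minimax_c \<Omega> \<phi>1 r > minimax_c \<Omega> \<phi>1 r')"
proof -
  interpret eigenpair \<Omega> \<phi>1
    using assms by unfold_locales (auto simp: bounded_C11_domain_def)
  let ?c = "minimax_c \<Omega> \<phi>1"
  have strict: "r + ?c r < r' + ?c r'" "?c r' < ?c r" if "r < r'" for r r'
    using minimax_strict[of "- r'" "- r"] minimax_strict[OF that] that
    by (simp_all add: minimax_reflect)
  have "1-lipschitz_on UNIV ?c"
  proof (rule lipschitz_onI)
    fix x y :: real
    show "dist (?c x) (?c y) \<le> 1 * dist x y"
      using strict[of x y] strict[of y x] by (cases x y rule: linorder_cases) (auto simp: dist_real_def)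
  qed simp
  then have "continuous_on UNIV ?c" by (rule lipschitz_on_continuous_on)
  then have "continuous_on {0..} ?c" by (rule continuous_on_subset) simp
  then have "continuous_on {0..} (\<lambda>r. (r + ?c r, ?c r))" by (intro continuous_intros)
  with strict show ?thesis by blast
qed

end
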